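(* Let $\mathbb{L}$ be a layer system over a signature $\mathcal{F}$ and let $\mathcal{R}$ be a TRS over $\mathcal{F}$ that is layered according to $\mathbb{L}$ and confluent on the terms of rank one, i.e. on $\mathbb{L}\cap\mathcal{T}(\mathcal{F},\mathcal{V})$. Then $\mathcal{R}$ is confluent.
   Context: Let $\mathcal{F}$ be a signature and $\mathcal{V}$ a countably infinite set of variables. $\square\notin\mathcal{F}\cup\mathcal{V}$ is a fresh constant (the hole). Contexts are the elements of $\mathcal{C}(\mathcal{F},\mathcal{V})=\mathcal{T}(\mathcal{F}\cup\{\square\},\mathcal{V})$, with any number of holes. $\sqsubseteq$ is the smallest reflexive, transitive, monotone relation on contexts with $\square\sqsubseteq C$ for all $C$. $C\sqcup D$ is the least upper bound with respect to $\sqsubseteq$, when it exists. $\mathrm{Pos}_{\mathcal{F}}(C)$ (resp. $\mathrm{Pos}_\square(C)$) is the set of positions of $C$ carrying a symbol of $\mathcal{F}$ (resp. a hole). Rules $\ell\to r$ satisfy $\ell\notin\mathcal{V}$ and $\mathrm{Var}(r)\subseteq\mathrm{Var}(\ell)$. Rewriting is extended to contexts by treating $\square$ as a constant. $s\to_{p,\ell\to r}t$ denotes a step at position $p$ with rule $\ell\to r$. Given $\mathbb{L}\subseteq\mathcal{C}(\mathcal{F},\mathcal{V})$, a top of $C$ is an $L\in\mathbb{L}$ with $L\sqsubseteq C$. A max-top is a $\sqsubseteq$-maximal top. $\mathbb{L}$ is a layer system if: (L1) every term in $\mathcal{T}(\mathcal{F},\mathcal{V})$ has a top other than $\square$; (L2)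 for $x\in\mathcal{V}$: $C[x]_p\in\mathbb{L}$ iff $C[\square]_p\in\mathbb{L}$; (L3) if $L,N\in\mathbb{L}$, $p\in\mathrm{Pos}_{\mathcal{F}}(L)$ and $L|_p\sqcup N$ is defined, then $L[L|_p\sqcup N]_p\in\mathbb{L}$. $\mathcal{R}$ is layered according to $\mathbb{L}$ if every rule $\ell\to r\in\mathcal{R}$ satisfies (W) and (C1), and $\mathbb{L}$ satisfies (C2): (W) whenever $M$ is a max-top of a term $s$, $p\in\mathrm{Pos}_{\mathcal{F}}(M)$ and $s\to_{p,\ell\to r}t$, then $M\to_{p,\ell\to r}L$ for some $L\in\mathbb{L}$; (C1) in (W), either $L$ is a max-top of $t$ or $L=\square$; (C2) if $L,N\in\mathbb{L}$ and $L\sqsubseteq N$, then $L[N|_p]_p\in\mathbb{L}$ for every $p\in\mathrm{Pos}_\square(L)$. Confluent on a set $S$ means $S$ is closed under rewriting and rewriting restricted to $S$ is confluent. *)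

theory Defs
  imports Main "HOL-Library.Confluence" "HOL-Library.Countable"
begin

text \<open>A signature is a set of symbols paired with their arities. The hole is a separate
  constructor, hence fresh for every signature, and terms are literally contexts without holes.\<close>

datatype ('f, 'v) ctxt =
    Hole ("\<box>")
  | Var 'v
  | Fun 'f "('f, 'v) ctxt list"

inductive_set ctxts :: "('f \<times> nat) set \<Rightarrow> ('f, 'v) ctxt set" for F where
  Hole: "\<box> \<in> ctxts F"
| Var: "Var x \<in> ctxts F"
| Fun: "(f, length ts) \<in> F \<Longrightarrow> \<forall>t \<in> set ts. t \<in> ctxts F \<Longrightarrow> Fun f ts \<in> ctxts F"

inductive_set terms :: "('f \<times> nat) set \<Rightarrow> ('f, 'v) ctxt set" for F where
  Var: "Var x \<in> terms F"
| Fun: "(f, length ts) \<in> F \<Longrightarrow> \<forall>t \<in> set ts. t \<in> terms F \<Longrightarrow> Fun f ts \<in> terms F"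

fun vars :: "('f, 'v) ctxt \<Rightarrow> 'v set" where
  "vars \<box> = {}"
| "vars (Var x) = {x}"
| "vars (Fun f ts) = (\<Union>t \<in> set ts. vars t)"

fun subst :: "('f, 'v) ctxt \<Rightarrow> ('v \<Rightarrow> ('f, 'v) ctxt) \<Rightarrow> ('f, 'v) ctxt" (infixl "\<cdot>" 67) where
  "\<box> \<cdot> \<sigma> = \<box>"
| "Var x \<cdot> \<sigma> = \<sigma> x"
| "Fun f ts \<cdot> \<sigma> = Fun f (map (\<lambda>t. t \<cdot> \<sigma>) ts)"

text \<open>Argument positions are counted from \<open>0\<close>. The functions \<open>subt_at\<close> and \<open>replace_at\<close>
  are only meaningful at positions of their first argument.\<close>

lemma size_nth_less [termination_simp]: "i < length ts \<Longrightarrow> f (ts ! i) < Suc (size_list f ts)"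
  by (metis le_refl less_Suc_eq_le nth_mem size_list_estimation')

fun poss :: "('f, 'v) ctxt \<Rightarrow> nat list set" where
  "poss \<box> = {[]}"
| "poss (Var x) = {[]}"
| "poss (Fun f ts) = insert [] (\<Union>i \<in> {..<length ts}. (#) i ` poss (ts ! i))"

fun subt_at :: "('f, 'v) ctxt \<Rightarrow> nat list \<Rightarrow> ('f, 'v) ctxt" where
  "subt_at C [] = C"
| "subt_at (Fun f ts) (i # p) = subt_at (ts ! i) p"

fun replace_at :: "('f, 'v) ctxt \<Rightarrow> nat list \<Rightarrow> ('f, 'v) ctxt \<Rightarrow> ('f, 'v) ctxt" where
  "replace_at C [] D = D"
| "replace_at (Fun f ts) (i # p) D = Fun f (ts[i := replace_at (ts ! i) p D])"

definition fun_poss :: "('f, 'v) ctxt \<Rightarrow> nat list set" where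
  "fun_poss C = {p \<in> poss C. \<exists>f ts. subt_at C p = Fun f ts}"

definition hole_poss :: "('f, 'v) ctxt \<Rightarrow> nat list set" where
  "hole_poss C = {p \<in> poss C. subt_at C p = \<box>}"

inductive ctxt_le :: "('f, 'v) ctxt \<Rightarrow> ('f, 'v) ctxt \<Rightarrow> bool" (infix "\<sqsubseteq>" 50) where
  hole: "\<box> \<sqsubseteq> C"
| refl: "C \<sqsubseteq> C"
| trans: "C \<sqsubseteq> D \<Longrightarrow> D \<sqsubseteq> E \<Longrightarrow> C \<sqsubseteq> E"
| mono: "C \<sqsubseteq> D \<Longrightarrow> Fun f (ss @ C # ts) \<sqsubseteq> Fun f (ss @ D # ts)"

text \<open>The order is defined on all contexts, without regard to a signature. As \<open>ctxts F\<close> is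
  downward closed, derivations between its elements stay inside it, so the restriction to
  \<open>ctxts F\<close> is the least such relation there.\<close>

lemma ctxt_le_ctxts: "C \<sqsubseteq> D \<Longrightarrow> D \<in> ctxts F \<Longrightarrow> C \<in> ctxts F"
proof (induction rule: ctxt_le.induct)
  case (mono C D f ss ts)
  from mono.prems show ?case
    by (cases rule: ctxts.cases) (auto intro!: ctxts.Fun mono.IH)
qed (auto intro: ctxts.Hole)

definition is_ctxt_lub ::
    "('f \<times> nat) set \<Rightarrow> ('f, 'v) ctxt \<Rightarrow> ('f, 'v) ctxt \<Rightarrow> ('f, 'v) ctxt \<Rightarrow> bool" where
  "is_ctxt_lub F C D E \<longleftrightarrow> E \<in> ctxts F \<and> C \<sqsubseteq> E \<and> D \<sqsubseteq> E \<and>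
     (\<forall>E' \<in> ctxts F. C \<sqsubseteq> E' \<and> D \<sqsubseteq> E' \<longrightarrow> E \<sqsubseteq> E')"

type_synonym ('f, 'v) rule = "('f, 'v) ctxt \<times> ('f, 'v) ctxt"

definition is_trs :: "('f \<times> nat) set \<Rightarrow> ('f, 'v) rule set \<Rightarrow> bool" where
  "is_trs F R \<longleftrightarrow> (\<forall>(l, r) \<in> R. l \<in> terms F \<and> r \<in> terms F \<and> (\<forall>x. l \<noteq> Var x) \<and> vars r \<subseteq> vars l)"

text \<open>Substitutions range over contexts. If \<open>s\<close> is a term, the left-hand side can only be
  matched with terms, and this is ordinary term rewriting.\<close>

definition step_at ::
    "nat list \<Rightarrow> ('f, 'v) rule \<Rightarrow> ('f, 'v) ctxt \<Rightarrow> ('f, 'v) ctxt \<Rightarrow> bool" where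
  "step_at p \<rho> s t \<longleftrightarrow> p \<in> poss s \<and>
     (\<exists>\<sigma>. subt_at s p = fst \<rho> \<cdot> \<sigma> \<and> t = replace_at s p (snd \<rho> \<cdot> \<sigma>))"

definition rstep :: "('f, 'v) rule set \<Rightarrow> ('f, 'v) ctxt \<Rightarrow> ('f, 'v) ctxt \<Rightarrow> bool" where
  "rstep R s t \<longleftrightarrow> (\<exists>p. \<exists>\<rho> \<in> R. step_at p \<rho> s t)"

definition rstep_on ::
    "('f, 'v) ctxt set \<Rightarrow> ('f, 'v) rule set \<Rightarrow> ('f, 'v) ctxt \<Rightarrow> ('f, 'v) ctxt \<Rightarrow> bool" where
  "rstep_on S R s t \<longleftrightarrow> s \<in> S \<and> t \<in> S \<and> rstep R s t"

definition confluent_on :: "('f, 'v) ctxt set \<Rightarrow> ('f, 'v) rule set \<Rightarrow> bool" where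
  "confluent_on S R \<longleftrightarrow> (\<forall>s t. s \<in> S \<and> rstep R s t \<longrightarrow> t \<in> S) \<and> confluentp (rstep_on S R)"

definition confluent_trs :: "('f \<times> nat) set \<Rightarrow> ('f, 'v) rule set \<Rightarrow> bool" where
  "confluent_trs F R \<longleftrightarrow> confluentp (rstep_on (terms F) R)"

definition is_top :: "('f, 'v) ctxt set \<Rightarrow> ('f, 'v) ctxt \<Rightarrow> ('f, 'v) ctxt \<Rightarrow> bool" where
  "is_top \<LL> C L \<longleftrightarrow> L \<in> \<LL> \<and> L \<sqsubseteq> C"

definition is_max_top :: "('f, 'v) ctxt set \<Rightarrow> ('f, 'v) ctxt \<Rightarrow> ('f, 'v) ctxt \<Rightarrow> bool" where
  "is_max_top \<LL> C M \<longleftrightarrow> is_top \<LL> C M \<and> (\<forall>L. is_top \<LL> C L \<and> M \<sqsubseteq> L \<longrightarrow> L = M)"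

definition L1 :: "('f \<times> nat) set \<Rightarrow> ('f, 'v) ctxt set \<Rightarrow> bool" where
  "L1 F \<LL> \<longleftrightarrow> (\<forall>t \<in> terms F. \<exists>L. is_top \<LL> t L \<and> L \<noteq> \<box>)"

definition L2 :: "('f \<times> nat) set \<Rightarrow> ('f, 'v) ctxt set \<Rightarrow> bool" where
  "L2 F \<LL> \<longleftrightarrow> (\<forall>x. \<forall>C \<in> ctxts F. \<forall>p \<in> poss C.
     replace_at C p (Var x) \<in> \<LL> \<longleftrightarrow> replace_at C p \<box> \<in> \<LL>)"

definition L3 :: "('f \<times> nat) set \<Rightarrow> ('f, 'v) ctxt set \<Rightarrow> bool" where
  "L3 F \<LL> \<longleftrightarrow> (\<forall>L \<in> \<LL>. \<forall>N \<in> \<LL>. \<forall>p \<in> fun_poss L. \<forall>E.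
     is_ctxt_lub F (subt_at L p) N E \<longrightarrow> replace_at L p E \<in> \<LL>)"

definition layer_system :: "('f \<times> nat) set \<Rightarrow> ('f, 'v) ctxt set \<Rightarrow> bool" where
  "layer_system F \<LL> \<longleftrightarrow> \<LL> \<subseteq> ctxts F \<and> L1 F \<LL> \<and> L2 F \<LL> \<and> L3 F \<LL>"

definition W :: "('f \<times> nat) set \<Rightarrow> ('f, 'v) ctxt set \<Rightarrow> ('f, 'v) rule \<Rightarrow> bool" where
  "W F \<LL> \<rho> \<longleftrightarrow> (\<forall>s \<in> terms F. \<forall>M t. \<forall>p \<in> fun_poss M.
     is_max_top \<LL> s M \<and> step_at p \<rho> s t \<longrightarrow> (\<exists>L \<in> \<LL>. step_at p \<rho> M L))"

definition C1 :: "('f \<times> nat) set \<Rightarrow> ('f, 'v) ctxt set \<Rightarrow> ('f, 'v) rule \<Rightarrow> bool" where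
  "C1 F \<LL> \<rho> \<longleftrightarrow> (\<forall>s \<in> terms F. \<forall>M t. \<forall>p \<in> fun_poss M.
     is_max_top \<LL> s M \<and> step_at p \<rho> s t \<longrightarrow>
       (\<forall>L \<in> \<LL>. step_at p \<rho> M L \<longrightarrow> is_max_top \<LL> t L \<or> L = \<box>))"

definition C2 :: "('f, 'v) ctxt set \<Rightarrow> bool" where
  "C2 \<LL> \<longleftrightarrow> (\<forall>L \<in> \<LL>. \<forall>N \<in> \<LL>. L \<sqsubseteq> N \<longrightarrow>
     (\<forall>p \<in> hole_poss L. replace_at L p (subt_at N p) \<in> \<LL>))"

text \<open>By the variable condition on rules, the \<open>L\<close> with \<open>step_at p \<rho> M L\<close> is unique, so the
  existential in \<open>W\<close> and the universal in \<open>C1\<close> speak about the same \<open>L\<close>.\<close>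

definition layered ::
    "('f \<times> nat) set \<Rightarrow> ('f, 'v) ctxt set \<Rightarrow> ('f, 'v) rule set \<Rightarrow> bool" where
  "layered F \<LL> R \<longleftrightarrow> (\<forall>\<rho> \<in> R. W F \<LL> \<rho> \<and> C1 F \<LL> \<rho>) \<and> C2 \<LL>"

end

theory Submission
  imports Defs
begin

text \<open>The proof adapts van Oostrom's constructive proof of modularity. Induct on the rank, the
  nesting depth of max-tops. In a term of rank \<open>r + 1\<close>, call the aliens of rank exactly \<open>r\<close> tall.
  A short step does not take place inside a tall alien; replacing the tall aliens by fresh
  variables turns it into a step between terms of rank at most \<open>r\<close>, so short steps are confluent by
  the induction hypothesis. A tall step reduces all tall aliens in parallel, and its label is the
  number of distinct results. A peak of two tall steps is closed by common reducts that identify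
  whatever either step identifies, so the label does not grow. In a peak of a short and a tall
  step, the tall results first have to be balanced, so that equal tall aliens are equal again and
  the short step still applies; if this takes any reduction, the label drops strictly. Thus the
  peaks are decreasing and induction on the label gives confluence. Condition (C2) ensures that a
  step inside one alien does not let the max-top absorb a different one.\<close>

subsection \<open>Contexts and positions\<close>

text \<open>Rules that are not left-linear are the reason for labels and balancing: a redex in the
  max-top may need two tall aliens to be equal, while a tall step may send equal aliens to different
  results. The count of distinct results is the right measure because common reducts are chosen by a
  map on results: if the map is injective, results of equal aliens already agree; otherwise the
  count drops. Confluence in lower rank makes joinability transitive, so a single map serves all
  tall aliens. The other obstacle is that a reduct may have a larger max-top than its source. Tall
  steps are therefore described over the max-top of the source, and positions that cease to be tall
  are finished by short steps. The induction goes from rank \<open>k + 1\<close> to rank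
  \<open>k + 2\<close>, so tall means not of rank at most \<open>k\<close>. With fresh variables for
  the tall aliens, (L2) extends the max-top to a top of the new term; the aliens left over it have
  rank at most \<open>k\<close>, so the new term has rank at most \<open>k + 1\<close>.\<close>

lemma le_Hole [simp]: "C \<sqsubseteq> \<box> \<longleftrightarrow> C = \<box>"
proof -
  have "C \<sqsubseteq> D \<Longrightarrow> D = \<box> \<Longrightarrow> C = \<box>" for C D
    by (induction rule: ctxt_le.induct) auto
  then show ?thesis by (auto intro: ctxt_le.refl)
qed

lemma Var_le [simp]: "Var x \<sqsubseteq> D \<longleftrightarrow> D = Var x"
proof -
  have "C \<sqsubseteq> D \<Longrightarrow> C = Var x \<Longrightarrow> D = Var x" for C D
    by (induction rule: ctxt_le.induct) auto
  then show ?thesis by (auto intro: ctxt_le.refl)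
qed

lemma Fun_le: "Fun f cs \<sqsubseteq> D \<longleftrightarrow>
  (\<exists>ds. D = Fun f ds \<and> length ds = length cs \<and> (\<forall>i < length cs. cs ! i \<sqsubseteq> ds ! i))"
proof -
  have "C \<sqsubseteq> D \<Longrightarrow> C = Fun f cs \<Longrightarrow> \<exists>ds. D = Fun f ds \<and> list_all2 (\<sqsubseteq>) cs ds" for C
  proof (induction arbitrary: cs rule: ctxt_le.induct)
    case (trans C D E)
    then show ?case by (force simp: list_all2_conv_all_nth intro: ctxt_le.trans)
  next
    case (mono C D g ss ts)
    then have "g = f" "cs = ss @ C # ts" by simp_all
    moreover have "list_all2 (\<sqsubseteq>) (ss @ C # ts) (ss @ D # ts)"
      using mono.hyps by (simp add: list_all2_conv_all_nth nth_append nth_Cons' ctxt_le.refl)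
    ultimately show ?case by (intro exI[of _ "ss @ D # ts"]) simp
  next
    case (refl C)
    then show ?case by (simp add: list_all2_conv_all_nth ctxt_le.refl)
  qed simp
  \<comment> \<open>\<open>ctxt_le.mono\<close> changes a single argument, so the arguments are
    enlarged from left to right; the prefix \<open>ss\<close> holds those already done.\<close>
  moreover have "Fun f (ss @ cs) \<sqsubseteq> Fun f (ss @ ds)" if "list_all2 (\<sqsubseteq>) cs ds" for ss ds
    using that
  proof (induction arbitrary: ss rule: list_all2_induct)
    case (Cons c cs d ds)
    then show ?case
      using ctxt_le.trans[OF ctxt_le.mono[of c d f ss cs] Cons.IH[of "ss @ [d]", simplified]]
      by simp
  qed (auto intro: ctxt_le.refl)
  from this[of _ "[]"] have "Fun f cs \<sqsubseteq> Fun f ds" if "list_all2 (\<sqsubseteq>) cs ds" for ds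
    using that by simp
  ultimately show ?thesis by (fastforce simp: list_all2_conv_all_nth)
qed

lemma le_Var: "C \<sqsubseteq> Var x \<longleftrightarrow> C = \<box> \<or> C = Var x"
  by (cases C) (auto simp: Fun_le intro: ctxt_le.hole)

lemma le_Fun: "C \<sqsubseteq> Fun f ds \<longleftrightarrow> C = \<box> \<or>
  (\<exists>cs. C = Fun f cs \<and> length cs = length ds \<and> (\<forall>i < length ds. cs ! i \<sqsubseteq> ds ! i))"
  by (cases C) (auto simp: Fun_le intro: ctxt_le.hole)

lemma ctxt_le_antisym: "C \<sqsubseteq> D \<Longrightarrow> D \<sqsubseteq> C \<Longrightarrow> C = D"
proof (induction C arbitrary: D)
  case (Fun f cs)
  then obtain ds where "D = Fun f ds" "length ds = length cs" "\<forall>i < length cs. cs ! i \<sqsubseteq> ds ! i"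
    by (auto simp: Fun_le)
  with Fun show ?case by (auto simp: Fun_le intro!: nth_equalityI)
qed auto

text \<open>The common upper bound \<open>s\<close> rules out clashes of symbols, so the bound is
  built argument by argument; where one side is a hole, the other side is the bound.\<close>

lemma lub_exists:
  assumes "C \<sqsubseteq> s" "D \<sqsubseteq> s"
  shows "\<exists>E. E \<sqsubseteq> s \<and> C \<sqsubseteq> E \<and> D \<sqsubseteq> E \<and> (\<forall>E'. C \<sqsubseteq> E' \<and> D \<sqsubseteq> E' \<longrightarrow> E \<sqsubseteq> E')"
  using assms
proof (induction s arbitrary: C D rule: ctxt.induct)
  case (Fun f ss)
  consider "C = \<box>" | "D = \<box>"
    | cs ds where "C = Fun f cs" "D = Fun f ds" "length cs = length ss" "length ds = length ss"
      "\<forall>i < length ss. cs ! i \<sqsubseteq> ss ! i \<and> ds ! i \<sqsubseteq> ss ! i"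
    using Fun.prems by (auto simp: le_Fun)
  then show ?case
  proof cases
    case 3
    then have "\<forall>i. \<exists>E. i < length ss \<longrightarrow> E \<sqsubseteq> ss ! i \<and> cs ! i \<sqsubseteq> E \<and> ds ! i \<sqsubseteq> E \<and>
        (\<forall>E'. cs ! i \<sqsubseteq> E' \<and> ds ! i \<sqsubseteq> E' \<longrightarrow> E \<sqsubseteq> E')"
      using Fun.IH by (meson nth_mem)
    then obtain E where "\<And>i. i < length ss \<Longrightarrow> E i \<sqsubseteq> ss ! i \<and> cs ! i \<sqsubseteq> E i \<and> ds ! i \<sqsubseteq> E i \<and>
        (\<forall>E'. cs ! i \<sqsubseteq> E' \<and> ds ! i \<sqsubseteq> E' \<longrightarrow> E i \<sqsubseteq> E')"
      by metis
    then show ?thesis using 3 by (intro exI[of _ "Fun f (map E [0..<length ss])"]) (auto simp: Fun_le)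
  qed (use Fun.prems in \<open>auto intro: ctxt_le.hole ctxt_le.refl\<close>)
qed (auto simp: le_Var intro: ctxt_le.hole)

lemma Nil_in_poss [simp]: "[] \<in> poss C"
  by (cases C) auto

lemma Cons_in_poss_Fun [simp]: "i # p \<in> poss (Fun f ts) \<longleftrightarrow> i < length ts \<and> p \<in> poss (ts ! i)"
  by auto

declare poss.simps(3) [simp del]

lemma Cons_in_poss: "i # p \<in> poss C \<longleftrightarrow> (\<exists>f ts. C = Fun f ts \<and> i < length ts \<and> p \<in> poss (ts ! i))"
  by (cases C) auto

lemma finite_poss: "finite (poss C)"
  by (induction C) (auto simp: poss.simps(3))

lemma hole_poss_simps [simp]:
  "[] \<in> hole_poss C \<longleftrightarrow> C = \<box>"
  "hole_poss \<box> = {[]}"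
  "hole_poss (Var x) = {}"
  "i # p \<in> hole_poss (Fun f ts) \<longleftrightarrow> i < length ts \<and> p \<in> hole_poss (ts ! i)"
  by (auto simp: hole_poss_def)

lemma hole_poss_iff: "p \<in> hole_poss C \<longleftrightarrow> p \<in> poss C \<and> subt_at C p = \<box>"
  by (simp add: hole_poss_def)

lemma hole_poss_Fun: "hole_poss (Fun f ts) = (\<Union>i < length ts. (#) i ` hole_poss (ts ! i))"
proof (intro set_eqI)
  show "p \<in> hole_poss (Fun f ts) \<longleftrightarrow> p \<in> (\<Union>i < length ts. (#) i ` hole_poss (ts ! i))" for p
    by (cases p) auto
qed

lemma finite_hole_poss: "finite (hole_poss C)"
  by (rule finite_subset[OF _ finite_poss]) (auto simp: hole_poss_def)

lemma fun_poss_iff: "p \<in> fun_poss C \<longleftrightarrow> p \<in> poss C \<and> (\<exists>f ts. subt_at C p = Fun f ts)"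
  by (simp add: fun_poss_def)

lemma poss_append: "p @ q \<in> poss C \<longleftrightarrow> p \<in> poss C \<and> q \<in> poss (subt_at C p)"
  by (induction p arbitrary: C) (auto simp: Cons_in_poss)

lemma subt_at_append: "p \<in> poss C \<Longrightarrow> subt_at C (p @ q) = subt_at (subt_at C p) q"
  by (induction p arbitrary: C) (auto simp: Cons_in_poss)

lemma hole_poss_append:
  "p \<in> poss C \<Longrightarrow> p @ q \<in> hole_poss C \<longleftrightarrow> q \<in> hole_poss (subt_at C p)"
  by (auto simp: hole_poss_iff poss_append subt_at_append)

lemma replace_at_append:
  "p \<in> poss C \<Longrightarrow> replace_at C (p @ q) D = replace_at C p (replace_at (subt_at C p) q D)"
  by (induction p arbitrary: C) (auto simp: Cons_in_poss)

lemma subt_at_replace_at [simp]: "p \<in> poss C \<Longrightarrow> subt_at (replace_at C p D) p = D"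
  by (induction p arbitrary: C) (auto simp: Cons_in_poss)

lemma poss_replace_at [simp]: "p \<in> poss C \<Longrightarrow> p \<in> poss (replace_at C p D)"
  by (induction p arbitrary: C) (auto simp: Cons_in_poss)

lemma replace_at_subt_at [simp]: "p \<in> poss C \<Longrightarrow> replace_at C p (subt_at C p) = C"
  by (induction p arbitrary: C) (auto simp: Cons_in_poss)

lemma replace_at_eq_Hole: "p \<in> poss C \<Longrightarrow> replace_at C p D = \<box> \<longleftrightarrow> p = [] \<and> D = \<box>"
  by (cases p) (auto simp: Cons_in_poss)

definition parallel :: "nat list \<Rightarrow> nat list \<Rightarrow> bool" where
  "parallel p q \<longleftrightarrow> (\<nexists>r. p = q @ r) \<and> (\<nexists>r. q = p @ r)"

lemma parallel_Nil [simp]: "\<not> parallel [] q" "\<not> parallel p []"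
  by (auto simp: parallel_def)

lemma parallel_Cons [simp]: "parallel (i # p) (j # q) \<longleftrightarrow> i \<noteq> j \<or> parallel p q"
  by (auto simp: parallel_def)

lemma parallel_append: "parallel p q \<Longrightarrow> parallel (p @ r) q"
  by (induction p arbitrary: q) (auto, metis parallel_Cons parallel_Nil(2) list.exhaust)

lemma replace_at_parallel:
  assumes "p \<in> poss C" "parallel p q"
  shows "q \<in> poss (replace_at C p D) \<longleftrightarrow> q \<in> poss C"
    and "q \<in> poss C \<Longrightarrow> subt_at (replace_at C p D) q = subt_at C q"
  using assms
proof (induction p arbitrary: C q)
  case (Cons i p)
  { case 1 with Cons show ?case
      by (cases q) (auto simp: Cons_in_poss nth_list_update split: if_splits) }
  { case 2 with Cons show ?case by (cases q) (auto simp: Cons_in_poss nth_list_update) }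
qed simp_all

lemma hole_poss_antichain: "o1 \<in> hole_poss C \<Longrightarrow> o1 @ w \<in> hole_poss C \<Longrightarrow> w = []"
  by (auto simp: hole_poss_iff poss_append)

lemma hole_poss_parallel:
  "o1 \<in> hole_poss C \<Longrightarrow> o2 \<in> hole_poss C \<Longrightarrow> o1 \<noteq> o2 \<Longrightarrow> parallel o1 o2"
  by (auto simp: parallel_def dest: hole_poss_antichain)

lemma le_poss: "C \<sqsubseteq> D \<Longrightarrow> p \<in> poss C \<Longrightarrow> p \<in> poss D"
  by (induction p arbitrary: C D rule: list.induct) (force simp: Cons_in_poss Fun_le)+

lemma le_subt_at: "C \<sqsubseteq> D \<Longrightarrow> p \<in> poss C \<Longrightarrow> subt_at C p \<sqsubseteq> subt_at D p"
  by (induction p arbitrary: C D rule: list.induct) (auto simp: Cons_in_poss Fun_le)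

lemma replace_at_mono:
  "C \<sqsubseteq> D \<Longrightarrow> p \<in> poss C \<Longrightarrow> E \<sqsubseteq> E' \<Longrightarrow> replace_at C p E \<sqsubseteq> replace_at D p E'"
  by (induction p arbitrary: C D rule: list.induct) (auto simp: Cons_in_poss Fun_le nth_list_update)

lemma replace_at_le:
  "C \<sqsubseteq> D \<Longrightarrow> p \<in> poss C \<Longrightarrow> E \<sqsubseteq> subt_at D p \<Longrightarrow> replace_at C p E \<sqsubseteq> D"
  by (metis replace_at_mono replace_at_subt_at le_poss)

lemma le_replace_at_hole:
  "C \<sqsubseteq> D \<Longrightarrow> p \<in> hole_poss C \<Longrightarrow> C \<sqsubseteq> replace_at D p E"
  by (metis hole_poss_iff replace_at_mono replace_at_subt_at ctxt_le.hole)

text \<open>A larger context differs from \<open>C\<close> only below the holes of \<open>C\<close>.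
  This assigns the aliens of a refined top to those of a smaller one.\<close>

lemma hole_poss_le_cases:
  assumes "C \<sqsubseteq> D" "p \<in> hole_poss D"
  obtains o1 o2 where "p = o1 @ o2" "o1 \<in> hole_poss C" "o2 \<in> hole_poss (subt_at D o1)"
proof -
  have "\<exists>o1 o2. p = o1 @ o2 \<and> o1 \<in> hole_poss C \<and> o2 \<in> hole_poss (subt_at D o1)"
    using assms
  proof (induction p arbitrary: C D rule: list.induct)
    case (Cons i p)
    show ?case
    proof (cases "C = \<box>")
      case False
      obtain f ds where D: "D = Fun f ds" "i < length ds" "p \<in> hole_poss (ds ! i)"
        using Cons.prems by (auto simp: hole_poss_iff Cons_in_poss)
      then obtain cs where C: "C = Fun f cs" "length cs = length ds" "cs ! i \<sqsubseteq> ds ! i"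
        using Cons.prems False by (auto simp: le_Fun)
      from Cons.IH[OF C(3) D(3)] obtain o1 o2 where
        "p = o1 @ o2" "o1 \<in> hole_poss (cs ! i)" "o2 \<in> hole_poss (subt_at (ds ! i) o1)" by blast
      then show ?thesis using C D by (intro exI[of _ "i # o1"] exI[of _ o2]) auto
    qed (use Cons.prems in \<open>auto intro!: exI[of _ "[]"]\<close>)
  qed auto
  then show ?thesis using that by blast
qed

lemma poss_le_cases:
  assumes "C \<sqsubseteq> s" "p \<in> poss s"
  obtains "p \<in> poss C" "subt_at C p \<noteq> \<box>" | q p' where "p = q @ p'" "q \<in> hole_poss C"
proof -
  have "p \<in> poss C \<and> subt_at C p \<noteq> \<box> \<or> (\<exists>q p'. p = q @ p' \<and> q \<in> hole_poss C)"
    using assms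
  proof (induction p arbitrary: C s rule: list.induct)
    case (Cons i p)
    show ?case
    proof (cases "C = \<box>")
      case False
      obtain f ds where D: "s = Fun f ds" "i < length ds" "p \<in> poss (ds ! i)"
        using Cons.prems by (auto simp: Cons_in_poss)
      then obtain cs where C: "C = Fun f cs" "length cs = length ds" "cs ! i \<sqsubseteq> ds ! i"
        using Cons.prems False by (auto simp: le_Fun)
      from Cons.IH[OF C(3) D(3)] C D show ?thesis
        by (metis Cons_in_poss_Fun subt_at.simps(2) append_Cons hole_poss_simps(4))
    qed auto
  qed auto
  then show ?thesis using that by blast
qed

lemma le_neq_hole:
  assumes "C \<sqsubseteq> D" "C \<noteq> D"
  shows "\<exists>p \<in> hole_poss C. subt_at D p \<noteq> \<box>"
  using assms
proof (induction C arbitrary: D rule: ctxt.induct)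
  case (Fun f cs)
  then obtain ds where D: "D = Fun f ds" "length ds = length cs" "\<forall>i < length cs. cs ! i \<sqsubseteq> ds ! i"
    by (auto simp: Fun_le)
  with Fun.prems obtain i where i: "i < length cs" "cs ! i \<noteq> ds ! i"
    by (metis nth_equalityI)
  then obtain p where "p \<in> hole_poss (cs ! i)" "subt_at (ds ! i) p \<noteq> \<box>"
    using Fun.IH[of "cs ! i" "ds ! i"] D by auto
  then show ?case using D i by (intro bexI[of _ "i # p"]) auto
qed auto

section \<open>Filling holes, and the aliens below a context\<close>

text \<open>The filling is indexed by positions, so that equal aliens may be replaced
  differently.\<close>

fun fill :: "('f, 'v) ctxt \<Rightarrow> (nat list \<Rightarrow> ('f, 'v) ctxt) \<Rightarrow> ('f, 'v) ctxt" where
  "fill \<box> b = b []"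
| "fill (Var x) b = Var x"
| "fill (Fun f Cs) b = Fun f (map (\<lambda>i. fill (Cs ! i) (\<lambda>p. b (i # p))) [0..<length Cs])"

lemma fill_cong: "(\<And>p. p \<in> hole_poss C \<Longrightarrow> b p = b' p) \<Longrightarrow> fill C b = fill C b'"
  by (induction C b arbitrary: b' rule: fill.induct) (auto)

lemma le_fill: "C \<sqsubseteq> fill C b"
  by (induction C b rule: fill.induct) (auto simp: Fun_le intro: ctxt_le.hole)

lemma subt_at_fill:
  "p \<in> poss C \<Longrightarrow> subt_at (fill C b) p = fill (subt_at C p) (\<lambda>q. b (p @ q))"
  by (induction p arbitrary: C b) (auto simp: Cons_in_poss)

lemma subt_at_fill_hole: "p \<in> hole_poss C \<Longrightarrow> subt_at (fill C b) p = b p"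
  by (simp add: hole_poss_iff subt_at_fill)

lemma fill_subt_at [simp]: "C \<sqsubseteq> s \<Longrightarrow> fill C (subt_at s) = s"
proof (induction C arbitrary: s)
  case (Fun f cs)
  then show ?case by (auto simp: Fun_le intro!: nth_equalityI)
qed auto

text \<open>Lets a term presented over a larger context, typically the max-top after a step, be
  compared hole by hole with one presented over \<open>C\<close>.\<close>

lemma fill_le: "C \<sqsubseteq> D \<Longrightarrow> fill D b = fill C (\<lambda>p. fill (subt_at D p) (\<lambda>q. b (p @ q)))"
proof (induction C arbitrary: D b)
  case (Fun f cs)
  then obtain ds where "D = Fun f ds" "length ds = length cs" "\<forall>i < length cs. cs ! i \<sqsubseteq> ds ! i"
    by (auto simp: Fun_le)
  then show ?case using Fun.IH[OF nth_mem, of _ "ds ! _" "\<lambda>p. b (_ # p)"] by simp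
qed auto

lemma replace_at_fill:
  assumes "p \<in> hole_poss C"
  shows "replace_at (fill C b) p u = fill C (b(p := u))"
  using assms
proof (induction p arbitrary: C b)
  case (Cons i p)
  then obtain f cs where C: "C = Fun f cs" "i < length cs" "p \<in> hole_poss (cs ! i)"
    by (auto simp: hole_poss_iff Cons_in_poss)
  have "fill (cs ! j) (\<lambda>q. (b(i # p := u)) (j # q)) =
      (if j = i then replace_at (fill (cs ! i) (\<lambda>q. b (i # q))) p u
       else fill (cs ! j) (\<lambda>q. b (j # q)))" for j
    using Cons.IH[OF C(3)] by (auto intro!: fill_cong)
  then show ?case using C by (auto intro!: nth_equalityI simp: nth_list_update)
qed auto

definition aliens :: "('f, 'v) ctxt \<Rightarrow> ('f, 'v) ctxt \<Rightarrow> ('f, 'v) ctxt set" where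
  "aliens C s = subt_at s ` hole_poss C"

text \<open>In contrast to \<open>fill\<close>, the replacement depends on the alien alone: equal
  aliens stay equal, which keeps rules that are not left-linear applicable.\<close>

definition map_aliens ::
    "(('f, 'v) ctxt \<Rightarrow> ('f, 'v) ctxt) \<Rightarrow> ('f, 'v) ctxt \<Rightarrow> ('f, 'v) ctxt \<Rightarrow> ('f, 'v) ctxt" where
  "map_aliens \<phi> C s = fill C (\<lambda>p. \<phi> (subt_at s p))"

lemma aliens_simps [simp]:
  "aliens \<box> s = {s}"
  "aliens (Var x) s = {}"
  "length ss = length cs \<Longrightarrow>
    aliens (Fun f cs) (Fun g ss) = (\<Union>i < length cs. aliens (cs ! i) (ss ! i))"
  by (auto simp: aliens_def hole_poss_Fun image_image image_UN)

lemma map_aliens_simps [simp]: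
  "map_aliens \<phi> \<box> s = \<phi> s"
  "map_aliens \<phi> (Var x) s = Var x"
  "map_aliens \<phi> (Fun f cs) (Fun g ss) =
    Fun f (map (\<lambda>i. map_aliens \<phi> (cs ! i) (ss ! i)) [0..<length cs])"
  by (auto simp: map_aliens_def)

lemma map_aliens_id:
  assumes "C \<sqsubseteq> s" "\<And>a. a \<in> aliens C s \<Longrightarrow> \<phi> a = a"
  shows "map_aliens \<phi> C s = s"
proof -
  have "map_aliens \<phi> C s = fill C (subt_at s)"
    unfolding map_aliens_def by (rule fill_cong) (use assms(2) in \<open>auto simp: aliens_def\<close>)
  then show ?thesis using assms(1) by simp
qed

lemma aliens_subt_at: "p \<in> poss C \<Longrightarrow> C \<sqsubseteq> s \<Longrightarrow> aliens (subt_at C p) (subt_at s p) \<subseteq> aliens C s"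
  by (auto simp: aliens_def subt_at_append le_poss hole_poss_append intro!: image_eqI[of _ _ "p @ _"])

text \<open>The term \<open>l\<close> has no holes of its own, so all holes of
  \<open>l \<cdot> \<tau>\<close> lie in instances of variables. In the applications
  \<open>\<tau>\<close> matches a rule in a max-top and \<open>\<sigma>\<close> matches it in the
  term itself.\<close>

lemma aliens_subst:
  assumes "l \<in> terms F"
  shows "aliens (l \<cdot> \<tau>) (l \<cdot> \<sigma>) = (\<Union>z \<in> vars l. aliens (\<tau> z) (\<sigma> z))"
  using assms
proof induction
  case (Fun f ts)
  have "set ts = (!) ts ` {..<length ts}" by (auto simp: in_set_conv_nth)
  with Fun show ?case by simp
qed simp

text \<open>All occurrences of a variable \<open>z\<close> share \<open>\<tau> z\<close> and
  \<open>\<sigma> z\<close>, hence receive the same image, and the result is again an instance of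
  \<open>l\<close>.\<close>

lemma map_aliens_subst:
  assumes "l \<in> terms F"
  shows "map_aliens \<phi> (l \<cdot> \<tau>) (l \<cdot> \<sigma>) = l \<cdot> (\<lambda>z. map_aliens \<phi> (\<tau> z) (\<sigma> z))"
  using assms by induction (auto intro!: nth_equalityI)

lemma subt_at_map_aliens:
  "p \<in> poss C \<Longrightarrow> C \<sqsubseteq> s \<Longrightarrow>
    subt_at (map_aliens \<phi> C s) p = map_aliens \<phi> (subt_at C p) (subt_at s p)"
  by (simp add: map_aliens_def subt_at_fill subt_at_append le_poss)

lemma aliens_replace_at:
  assumes "p \<in> poss C" "C \<sqsubseteq> s"
  shows "aliens (replace_at C p D) (replace_at s p u) \<subseteq> aliens C s \<union> aliens D u"
  using assms
proof (induction p arbitrary: C s)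
  case (Cons i p)
  then obtain f cs ss where C: "C = Fun f cs" "s = Fun f ss" "length ss = length cs"
    "i < length cs" "p \<in> poss (cs ! i)" "cs ! i \<sqsubseteq> ss ! i" by (auto simp: Cons_in_poss Fun_le)
  with Cons.IH[OF C(5,6)] show ?case by (fastforce simp: nth_list_update split: if_splits)
qed auto

lemma map_aliens_replace_at:
  assumes "p \<in> poss C" "C \<sqsubseteq> s"
  shows "map_aliens \<phi> (replace_at C p D) (replace_at s p u) =
    replace_at (map_aliens \<phi> C s) p (map_aliens \<phi> D u)"
  using assms
proof (induction p arbitrary: C s)
  case (Cons i p)
  then obtain f cs ss where C: "C = Fun f cs" "s = Fun f ss" "length ss = length cs"
    "i < length cs" "p \<in> poss (cs ! i)" "cs ! i \<sqsubseteq> ss ! i" by (auto simp: Cons_in_poss Fun_le)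
  with Cons.IH[OF C(5,6)] show ?case by (auto intro!: nth_equalityI simp: nth_list_update)
qed auto

lemma aliens_le:
  assumes "C \<sqsubseteq> D" "D \<sqsubseteq> s"
  shows "aliens D s = (\<Union>p \<in> hole_poss C. aliens (subt_at D p) (subt_at s p))"
proof -
  have "p \<in> poss D" "p \<in> poss s" if "p \<in> hole_poss C" for p
    using that assms by (auto simp: hole_poss_iff dest: le_poss)
  moreover have "subt_at s p \<in> (\<Union>p \<in> hole_poss C. aliens (subt_at D p) (subt_at s p))"
    if p: "p \<in> hole_poss D" for p
  proof -
    obtain o1 o2 where "p = o1 @ o2" "o1 \<in> hole_poss C" "o2 \<in> hole_poss (subt_at D o1)"
      by (rule hole_poss_le_cases[OF assms(1) p])
    then show ?thesis using calculation by (auto simp: aliens_def subt_at_append)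
  qed
  ultimately show ?thesis
    using aliens_subt_at[OF _ assms(2)] by (fastforce simp: aliens_def)
qed

lemma map_aliens_le:
  assumes "C \<sqsubseteq> D" "D \<sqsubseteq> s"
  shows "map_aliens \<phi> D s = fill C (\<lambda>p. map_aliens \<phi> (subt_at D p) (subt_at s p))"
proof -
  have "p \<in> poss s" if "p \<in> hole_poss C" for p
    using that assms by (auto simp: hole_poss_iff dest: le_poss)
  then show ?thesis unfolding map_aliens_def fill_le[OF assms(1)]
    by (intro fill_cong) (auto simp: subt_at_append)
qed

section \<open>Variables, substitutions, terms and single steps\<close>

lemma subst_fill: "(\<And>x. x \<in> vars C \<Longrightarrow> \<sigma> x = Var x) \<Longrightarrow> fill C b \<cdot> \<sigma> = fill C (\<lambda>p. b p \<cdot> \<sigma>)"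
proof (induction C b rule: fill.induct)
  case (3 f Cs b)
  have "fill (Cs ! i) (\<lambda>p. b (i # p)) \<cdot> \<sigma> = fill (Cs ! i) (\<lambda>p. b (i # p) \<cdot> \<sigma>)"
    if "i < length Cs" for i
    by (rule 3) (use that in \<open>auto intro!: 3(2) bexI[OF _ nth_mem]\<close>)
  then show ?case by simp
qed auto

lemma vars_subt_at: "p \<in> poss C \<Longrightarrow> vars (subt_at C p) \<subseteq> vars C"
  by (induction p arbitrary: C) (fastforce simp: Cons_in_poss)+

lemma vars_le: "C \<sqsubseteq> D \<Longrightarrow> vars C \<subseteq> vars D"
proof (induction C arbitrary: D)
  case (Fun f cs)
  then show ?case by (fastforce simp: Fun_le set_conv_nth)
qed auto

lemma vars_replace_at: "p \<in> poss C \<Longrightarrow> vars (replace_at C p D) \<subseteq> vars C \<union> vars D"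
proof (induction p arbitrary: C)
  case (Cons i p)
  then obtain f cs where "C = Fun f cs" "i < length cs" "p \<in> poss (cs ! i)"
    by (auto simp: Cons_in_poss)
  with Cons.IH[of "cs ! i"] show ?case
    by (fastforce dest!: set_update_subset_insert[THEN subsetD])
qed auto

lemma vars_subst: "vars (s \<cdot> \<sigma>) \<subseteq> (\<Union>x \<in> vars s. vars (\<sigma> x))"
  by (induction s) auto

lemma vars_subst_superset: "x \<in> vars s \<Longrightarrow> vars (\<sigma> x) \<subseteq> vars (s \<cdot> \<sigma>)"
  by (induction s) auto

lemma finite_vars: "finite (vars s)"
  by (induction s) auto

lemma subst_subst: "s \<cdot> \<sigma> \<cdot> \<tau> = s \<cdot> (\<lambda>x. \<sigma> x \<cdot> \<tau>)"
  by (induction s) auto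

lemma subst_cong: "(\<And>x. x \<in> vars s \<Longrightarrow> \<sigma> x = \<tau> x) \<Longrightarrow> s \<cdot> \<sigma> = s \<cdot> \<tau>"
  by (induction s) auto

lemma subst_Var: "(\<And>x. x \<in> vars s \<Longrightarrow> \<sigma> x = Var x) \<Longrightarrow> s \<cdot> \<sigma> = s"
  by (induction s) (auto intro: map_idI)

lemma terms_ctxts: "t \<in> terms F \<Longrightarrow> t \<in> ctxts F"
  by (induction rule: terms.induct) (auto intro: ctxts.intros)

lemma Fun_in_terms: "Fun f ts \<in> terms F \<longleftrightarrow> (f, length ts) \<in> F \<and> (\<forall>i < length ts. ts ! i \<in> terms F)"
  by (auto simp: terms.simps[of "Fun f ts" F] all_set_conv_all_nth)

lemma Hole_notin_terms [simp]: "\<box> \<notin> terms F"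
  by (auto elim: terms.cases)

lemma Var_in_terms [simp]: "Var x \<in> terms F"
  by (rule terms.Var)

lemma terms_subt_at: "s \<in> terms F \<Longrightarrow> p \<in> poss s \<Longrightarrow> subt_at s p \<in> terms F"
  by (induction p arbitrary: s) (auto simp: Cons_in_poss Fun_in_terms)

lemma terms_replace_at:
  "s \<in> terms F \<Longrightarrow> p \<in> poss s \<Longrightarrow> u \<in> terms F \<Longrightarrow> replace_at s p u \<in> terms F"
  by (induction p arbitrary: s) (auto simp: Cons_in_poss Fun_in_terms nth_list_update)

lemma hole_poss_terms [simp]: "s \<in> terms F \<Longrightarrow> hole_poss s = {}"
  using terms_subt_at by (force simp: hole_poss_iff)

lemma terms_fill:
  "C \<in> ctxts F \<Longrightarrow> (\<And>p. p \<in> hole_poss C \<Longrightarrow> b p \<in> terms F) \<Longrightarrow> fill C b \<in> terms F"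
proof (induction C b rule: fill.induct)
  case (3 f Cs b)
  from 3(2) show ?case
    by (cases rule: ctxts.cases) (use 3 in \<open>auto simp: Fun_in_terms\<close>)
qed auto

lemma terms_subst:
  "s \<in> terms F \<Longrightarrow> (\<And>x. x \<in> vars s \<Longrightarrow> \<sigma> x \<in> terms F) \<Longrightarrow> s \<cdot> \<sigma> \<in> terms F"
  by (induction rule: terms.induct) (force intro: terms.intros)+

lemma terms_subst_vars: "s \<cdot> \<sigma> \<in> terms F \<Longrightarrow> x \<in> vars s \<Longrightarrow> \<sigma> x \<in> terms F"
proof (induction s)
  case (Fun f ts)
  then show ?case by (auto simp: terms.simps[of "Fun f _" F])
qed auto

lemma subst_poss: "p \<in> poss s \<Longrightarrow> p \<in> poss (s \<cdot> \<sigma>)"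
  by (induction p arbitrary: s) (auto simp: Cons_in_poss)

lemma subst_subt_at: "p \<in> poss s \<Longrightarrow> subt_at (s \<cdot> \<sigma>) p = subt_at s p \<cdot> \<sigma>"
  by (induction p arbitrary: s) (auto simp: Cons_in_poss)

lemma subst_replace_at: "p \<in> poss s \<Longrightarrow> replace_at s p u \<cdot> \<sigma> = replace_at (s \<cdot> \<sigma>) p (u \<cdot> \<sigma>)"
  by (induction p arbitrary: s) (auto simp: Cons_in_poss map_update)

lemma step_at_subst: "step_at p \<rho> s t \<Longrightarrow> step_at p \<rho> (s \<cdot> \<sigma>) (t \<cdot> \<sigma>)"
  unfolding step_at_def
  by (force simp: subst_poss subst_subt_at subst_replace_at subst_subst)

lemma step_at_append:
  "step_at (q @ p) \<rho> s t \<longleftrightarrow> q \<in> poss s \<and> (\<exists>u. step_at p \<rho> (subt_at s q) u \<and> t = replace_at s q u)"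
  unfolding step_at_def by (fastforce simp: poss_append subt_at_append replace_at_append)

lemma subst_inj:
  "s \<cdot> \<sigma> = s \<cdot> \<tau> \<Longrightarrow> x \<in> vars s \<Longrightarrow> \<sigma> x = \<tau> x"
  by (induction s) auto

text \<open>A match is determined on the variables of the left-hand side, and the right-hand side
  has no others.\<close>

lemma step_at_det:
  assumes "vars (snd \<rho>) \<subseteq> vars (fst \<rho>)" "step_at p \<rho> s t" "step_at p \<rho> s u"
  shows "t = u"
proof -
  obtain \<sigma> \<tau> where "fst \<rho> \<cdot> \<sigma> = fst \<rho> \<cdot> \<tau>" "t = replace_at s p (snd \<rho> \<cdot> \<sigma>)"
    "u = replace_at s p (snd \<rho> \<cdot> \<tau>)" using assms(2,3) unfolding step_at_def by metis
  moreover have "snd \<rho> \<cdot> \<sigma> = snd \<rho> \<cdot> \<tau>"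
    by (rule subst_cong) (use subst_inj[OF calculation(1)] assms(1) in auto)
  ultimately show ?thesis by simp
qed

lemma size_subt_at: "p \<in> poss s \<Longrightarrow> p \<noteq> [] \<Longrightarrow> size (subt_at s p) < size s"
proof (induction p arbitrary: s)
  case (Cons i p)
  then obtain f ts where s: "s = Fun f ts" "i < length ts" "p \<in> poss (ts ! i)"
    by (auto simp: Cons_in_poss)
  then have "size (subt_at (ts ! i) p) \<le> size (ts ! i)"
    using Cons.IH[of "ts ! i"] by (cases "p = []") auto
  then show ?case using s size_nth_less[of i ts size] by simp
qed simp

lemma fill_mono: "(\<And>p. p \<in> hole_poss C \<Longrightarrow> b p \<sqsubseteq> b' p) \<Longrightarrow> fill C b \<sqsubseteq> fill C b'"
  by (induction C b arbitrary: b' rule: fill.induct) (auto simp: Fun_le)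

lemma rstep_replace_at: "q \<in> poss s \<Longrightarrow> rstep R (subt_at s q) u \<Longrightarrow> rstep R s (replace_at s q u)"
  unfolding rstep_def by (metis step_at_append)

lemma poss_fill: "q \<in> hole_poss C \<Longrightarrow> q \<in> poss (fill C b)"
  using le_poss[OF le_fill] by (auto simp: hole_poss_iff)

lemma fill_steps_upd:
  assumes "q \<in> hole_poss C" "(rstep R)\<^sup>*\<^sup>* (b q) u"
  shows "(rstep R)\<^sup>*\<^sup>* (fill C b) (fill C (b(q := u)))"
  using assms(2)
proof (induction rule: rtranclp_induct)
  case (step u v)
  have "rstep R (fill C (b(q := u))) (replace_at (fill C (b(q := u))) q v)"
    using assms(1) step.hyps(2) by (intro rstep_replace_at poss_fill) (simp_all add: subt_at_fill_hole)
  then have "rstep R (fill C (b(q := u))) (fill C (b(q := v)))"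
    by (simp only: replace_at_fill[OF assms(1)] fun_upd_upd)
  with step.IH show ?case by (rule rtranclp.rtrancl_into_rtrancl)
qed simp

lemma fill_steps:
  assumes "\<And>p. p \<in> hole_poss C \<Longrightarrow> (rstep R)\<^sup>*\<^sup>* (b p) (c p)"
  shows "(rstep R)\<^sup>*\<^sup>* (fill C b) (fill C c)"
proof -
  \<comment> \<open>Parallel reductions are carried out one hole at a time; \<open>P\<close> is the
    set of finished holes.\<close>
  have "(rstep R)\<^sup>*\<^sup>* (fill C b) (fill C (\<lambda>p. if p \<in> P then c p else b p))"
    if "finite P" "P \<subseteq> hole_poss C" for P
    using that
  proof (induction P)
    case (insert q P)
    let ?b = "\<lambda>p. if p \<in> P then c p else b p"
    have "(rstep R)\<^sup>*\<^sup>* (fill C ?b) (fill C (?b(q := c q)))"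
      using insert assms by (intro fill_steps_upd) auto
    moreover have "?b(q := c q) = (\<lambda>p. if p \<in> insert q P then c p else b p)" by auto
    ultimately show ?case using insert by auto
  qed simp
  from this[OF finite_hole_poss order_refl] show ?thesis
    using fill_cong[of C c "\<lambda>p. if p \<in> hole_poss C then c p else b p"] by simp
qed

subsection \<open>Confluence from labelled peaks\<close>

text \<open>A special case of decreasing diagrams with a direct proof. In a peak of \<open>S\<close>
  and \<open>T n\<close>, the side of the \<open>T n\<close>-reduct must be closed with labels
  strictly below \<open>n\<close>, while the other side may use one \<open>T\<close>-step of label
  up to \<open>n\<close>. This asymmetry leaves room for a balancing reduction.\<close>

lemma labelled_confluence:
  fixes S :: "'a \<Rightarrow> 'a \<Rightarrow> bool" and T :: "nat \<Rightarrow> 'a \<Rightarrow> 'a \<Rightarrow> bool"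
    and A :: "nat \<Rightarrow> 'a \<Rightarrow> 'a \<Rightarrow> bool"
  assumes A: "\<And>n. A n = (\<lambda>x y. S x y \<or> (\<exists>m < n. T m x y))\<^sup>*\<^sup>*"
    and SS: "\<And>s t u. S\<^sup>*\<^sup>* s t \<Longrightarrow> S\<^sup>*\<^sup>* s u \<Longrightarrow> \<exists>v. S\<^sup>*\<^sup>* t v \<and> S\<^sup>*\<^sup>* u v"
    and TT: "\<And>m n s t u. T m s t \<Longrightarrow> T n s u \<Longrightarrow> \<exists>i j t' u' v. i \<le> m \<and> i \<le> n \<and> j \<le> m \<and> j \<le> n \<and>
      T i t t' \<and> S\<^sup>*\<^sup>* t' v \<and> T j u u' \<and> S\<^sup>*\<^sup>* u' v"
    and ST: "\<And>n s t u. S s u \<Longrightarrow> T n s t \<Longrightarrow> \<exists>v. A n t v \<and> (S\<^sup>*\<^sup>* u v \<or> (\<exists>m \<le> n. T m u v))"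
  shows "A n s t \<Longrightarrow> A n s u \<Longrightarrow> \<exists>v. A n t v \<and> A n u v"
proof (induction n arbitrary: s t u)
  case 0
  then show ?case using SS by (simp add: A)
next
  case (Suc n)
  note IH = Suc.IH
  \<comment> \<open>\<open>X\<close> allows at most one step of label \<open>n\<close>, at the very
    beginning. It has the diamond property, and its iteration is \<open>A (Suc n)\<close>.\<close>
  define X where "X x y \<longleftrightarrow> (\<exists>z. (x = z \<or> T n x z) \<and> A n z y)" for x y
  have A_refl: "A n x x" for x by (simp add: A)
  have A_trans: "A n x z" if "A n x y" "A n y z" for x y z using that by (simp add: A)
  have S_A: "A n x y" if "S\<^sup>*\<^sup>* x y" for x y
    unfolding A using that by (rule rtranclp_mono[THEN predicate2D, rotated]) auto
  have T_A: "A n x y" if "T m x y" "m < n" for x y m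
    unfolding A using that by (intro r_into_rtranclp) auto
  have A_X: "X x y" if "A n x y" for x y using that by (auto simp: X_def)
  have X_A: "X x z" if "X x y" "A n y z" for x y z using that A_trans unfolding X_def by blast
  have TS_X: "X x z" if "T i x y" "S\<^sup>*\<^sup>* y z" "i \<le> n" for i x y z
    using that T_A[of i x y] S_A[of y z] A_trans unfolding X_def by (cases "i = n") auto
  have TT_X: "\<exists>v. X t v \<and> X u v" if "T n s t" "T n s u" for s t u
    using TT[OF that] TS_X by blast
  have peak: "\<exists>v. X u v \<and> A n t v" if su: "S s u \<or> (\<exists>m < n. T m s u)" and st: "T n s t" for s t u
    using su
  proof
    assume "S s u"
    from ST[OF this st] obtain v where "A n t v" "S\<^sup>*\<^sup>* u v \<or> (\<exists>m \<le> n. T m u v)" by blast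
    then show ?thesis using TS_X[of _ u v v] A_X S_A by blast
  next
    assume "\<exists>m < n. T m s u"
    then obtain m where m: "m < n" "T m s u" by blast
    \<comment> \<open>Both closing steps have labels at most \<open>m\<close>, hence below
      \<open>n\<close>.\<close>
    from TT[OF m(2) st] obtain i j t' u' v where "i \<le> m" "j \<le> m"
      "T i u u'" "S\<^sup>*\<^sup>* u' v" "T j t t'" "S\<^sup>*\<^sup>* t' v" by blast
    then show ?thesis using m(1) T_A S_A A_trans TS_X[of i u u' v] by (meson le_less_trans less_imp_le)
  qed
  \<comment> \<open>Tiling along the reduction from \<open>s\<close> to \<open>u\<close>: each tile
    pushes the \<open>T n\<close>-step past one step and leaves an \<open>X\<close>-step on the far
    side.\<close>
  have AT: "\<exists>v. X u v \<and> A n t v" if "A n s u" "T n s t" for s t u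
    using that unfolding A[of n, THEN fun_cong, THEN fun_cong, of s u]
  proof (induction arbitrary: t rule: converse_rtranclp_induct)
    case base
    then show ?case using A_refl by (auto simp: X_def)
  next
    case (step s s1)
    obtain v1 where v1: "X s1 v1" "A n t v1" using peak[OF step.hyps(1) step.prems] by blast
    then obtain w where w: "s1 = w \<or> T n s1 w" "A n w v1" by (auto simp: X_def)
    from w(1) obtain v2 where v2: "X u v2" "A n w v2"
    proof
      assume "s1 = w"
      then have "A n w u" using step.hyps(2) by (simp add: A)
      then show ?thesis using that A_X A_refl by blast
    qed (use step.IH in blast)
    \<comment> \<open>Both \<open>v1\<close> and \<open>v2\<close> are reached from \<open>w\<close>
      by \<open>A n\<close>, so the outer induction hypothesis joins them.\<close>
    show ?case using IH[OF w(2) v2(2)] v1 v2 X_A A_trans by blast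
  qed
  have AX: "\<exists>v. X u v \<and> A n t v" if su: "A n s u" and st: "X s t" for s t u
  proof -
    obtain t1 where "s = t1 \<or> T n s t1" "A n t1 t" using st unfolding X_def by blast
    moreover obtain v where "X u v" "A n t1 v" using calculation(1) AT[OF su] su A_X A_refl by blast
    ultimately show ?thesis using IH X_A by blast
  qed
  have XX: "\<exists>v. X t v \<and> X u v" if st: "X s t" and su: "X s u" for s t u
  proof -
    obtain t1 where t1: "s = t1 \<or> T n s t1" "A n t1 t" using st by (auto simp: X_def)
    obtain u1 where u1: "s = u1 \<or> T n s u1" "A n u1 u" using su by (auto simp: X_def)
    show ?thesis
    proof (cases "s = t1 \<or> s = u1")
      case True
      then show ?thesis using AX t1(2) u1(2) st su A_X by meson
    next
      case False
      then obtain v where v: "X t1 v" "X u1 v" using t1 u1 TT_X by blast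
      obtain v1 v2 where "X t v1" "A n v v1" "X u v2" "A n v v2"
        using AX[OF t1(2) v(1)] AX[OF u1(2) v(2)] by blast
      then show ?thesis using IH X_A by meson
    qed
  qed
  have conv: "X\<^sup>*\<^sup>* = A (Suc n)"
  proof -
    have "(\<lambda>x y. S x y \<or> (\<exists>m < Suc n. T m x y)) x y \<Longrightarrow> X x y" for x y
      using S_A[of x y] A_X[of x y] TS_X[of _ x y y] by (auto simp: less_Suc_eq_le)
    then have "A (Suc n) \<le> X\<^sup>*\<^sup>*" unfolding A by (intro rtranclp_mono) auto
    moreover have "A n \<le> A (Suc n)" unfolding A by (intro rtranclp_mono) (auto simp: less_Suc_eq)
    moreover have "T n x y \<Longrightarrow> A (Suc n) x y" for x y unfolding A by (intro r_into_rtranclp) auto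
    moreover have "A (Suc n) x z" if "A (Suc n) x y" "A (Suc n) y z" for x y z
      using that by (simp add: A)
    ultimately have "X x y \<Longrightarrow> A (Suc n) x y" for x y unfolding X_def by blast
    then have "X\<^sup>*\<^sup>* \<le> (A (Suc n))\<^sup>*\<^sup>*" by (intro rtranclp_mono) auto
    then show ?thesis using \<open>A (Suc n) \<le> X\<^sup>*\<^sup>*\<close> by (simp add: A antisym)
  qed
  have "strong_confluentp X" using XX by (intro strong_confluentpI) blast
  from strong_confluentp_imp_confluentp[OF this] have "confluentp X" .
  from confluentpD[OF this] show ?case using Suc.prems unfolding conv by blast
qed

subsection \<open>Max-tops and rank\<close>

locale layered_trs =
  fixes F :: "('f \<times> nat) set" and \<LL> :: "('f, 'v) ctxt set" and R :: "('f, 'v) rule set"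
  assumes layer_system: "layer_system F \<LL>" and trs: "is_trs F R" and layered: "layered F \<LL> R"
begin

lemma LL_ctxts: "L \<in> \<LL> \<Longrightarrow> L \<in> ctxts F"
  using layer_system unfolding layer_system_def by blast

lemma ex_top: "t \<in> terms F \<Longrightarrow> \<exists>L \<in> \<LL>. L \<sqsubseteq> t \<and> L \<noteq> \<box>"
  using layer_system unfolding layer_system_def L1_def is_top_def by blast

lemma LL_replace_Var:
  "C \<in> ctxts F \<Longrightarrow> p \<in> poss C \<Longrightarrow> replace_at C p (Var x) \<in> \<LL> \<longleftrightarrow> replace_at C p \<box> \<in> \<LL>"
  using layer_system unfolding layer_system_def L2_def by blast

text \<open>(L3) in usable form: the common upper bound \<open>u\<close> guarantees that the least
  upper bound is defined.\<close>

lemma LL_lub: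
  assumes "L \<in> \<LL>" "N \<in> \<LL>" "p \<in> fun_poss L" "subt_at L p \<sqsubseteq> u" "N \<sqsubseteq> u" "u \<in> ctxts F"
  obtains E where "E \<sqsubseteq> u" "subt_at L p \<sqsubseteq> E" "N \<sqsubseteq> E" "replace_at L p E \<in> \<LL>"
proof -
  obtain E where E: "E \<sqsubseteq> u" "subt_at L p \<sqsubseteq> E" "N \<sqsubseteq> E"
    "\<And>E'. subt_at L p \<sqsubseteq> E' \<Longrightarrow> N \<sqsubseteq> E' \<Longrightarrow> E \<sqsubseteq> E'"
    using lub_exists[OF assms(4,5)] by blast
  then have "is_ctxt_lub F (subt_at L p) N E"
    using ctxt_le_ctxts[OF E(1) assms(6)] by (auto simp: is_ctxt_lub_def)
  then show ?thesis
    using that E assms(1-3) layer_system unfolding layer_system_def L3_def by blast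
qed

lemma LL_replace_hole:
  "L \<in> \<LL> \<Longrightarrow> N \<in> \<LL> \<Longrightarrow> L \<sqsubseteq> N \<Longrightarrow> p \<in> hole_poss L \<Longrightarrow> replace_at L p (subt_at N p) \<in> \<LL>"
  using layered unfolding layered_def C2_def by blast

lemma rule_terms:
  assumes "\<rho> \<in> R"
  shows "fst \<rho> \<in> terms F" "snd \<rho> \<in> terms F" "vars (snd \<rho>) \<subseteq> vars (fst \<rho>)"
    "\<exists>f ts. fst \<rho> = Fun f ts"
proof -
  show *: "fst \<rho> \<in> terms F" "snd \<rho> \<in> terms F" "vars (snd \<rho>) \<subseteq> vars (fst \<rho>)"
    using trs assms by (auto simp: is_trs_def case_prod_beta)
  have "fst \<rho> \<noteq> Var x" for x using trs assms unfolding is_trs_def by fastforce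
  then show "\<exists>f ts. fst \<rho> = Fun f ts" using *(1) by (cases "fst \<rho>") auto
qed

lemma step_at_fun_poss:
  assumes "\<rho> \<in> R" "step_at p \<rho> s t"
  shows "p \<in> fun_poss s"
  using assms rule_terms(4)[OF assms(1)] by (auto simp: step_at_def fun_poss_iff)

lemma step_at_terms:
  assumes "\<rho> \<in> R" "step_at p \<rho> s t" "s \<in> terms F"
  shows "t \<in> terms F"
proof -
  obtain \<sigma> where \<sigma>: "p \<in> poss s" "subt_at s p = fst \<rho> \<cdot> \<sigma>" "t = replace_at s p (snd \<rho> \<cdot> \<sigma>)"
    using assms(2) unfolding step_at_def by blast
  have l: "fst \<rho> \<cdot> \<sigma> \<in> terms F" using \<sigma> terms_subt_at[OF assms(3) \<sigma>(1)] by simp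
  have "\<sigma> x \<in> terms F" if "x \<in> vars (snd \<rho>)" for x
    using terms_subst_vars[OF l, of x] rule_terms(3)[OF assms(1)] that by blast
  then show ?thesis
    using \<sigma> rule_terms(2)[OF assms(1)] assms(3) by (auto intro!: terms_replace_at terms_subst)
qed

lemma step_at_vars:
  assumes "\<rho> \<in> R" "step_at p \<rho> s t"
  shows "vars t \<subseteq> vars s"
proof -
  obtain \<sigma> where \<sigma>: "p \<in> poss s" "subt_at s p = fst \<rho> \<cdot> \<sigma>" "t = replace_at s p (snd \<rho> \<cdot> \<sigma>)"
    using assms(2) unfolding step_at_def by blast
  have "vars (snd \<rho> \<cdot> \<sigma>) \<subseteq> vars (fst \<rho> \<cdot> \<sigma>)"
    using vars_subst[of "snd \<rho>" \<sigma>] vars_subst_superset[of _ "fst \<rho>" \<sigma>] rule_terms(3)[OF assms(1)]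
    by blast
  also have "\<dots> \<subseteq> vars s" using vars_subt_at[OF \<sigma>(1)] \<sigma>(2) by simp
  finally show ?thesis using vars_replace_at[OF \<sigma>(1), of "snd \<rho> \<cdot> \<sigma>"] \<sigma>(3) by auto
qed

section \<open>Greatest tops\<close>

definition max_top :: "('f, 'v) ctxt \<Rightarrow> ('f, 'v) ctxt" where
  "max_top s = (THE M. is_max_top \<LL> s M)"

text \<open>Tops of \<open>s\<close> have bounded size, so one of maximal size exists; by (L1) it is
  not a hole. If its root is a function symbol, (L3) at the root merges it with any other top, and
  by maximality the merge adds nothing.\<close>

lemma greatest_top_exists:
  assumes "s \<in> terms F"
  obtains M where "M \<in> \<LL>" "M \<sqsubseteq> s" "\<And>L. L \<in> \<LL> \<Longrightarrow> L \<sqsubseteq> s \<Longrightarrow> L \<sqsubseteq> M"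
proof -
  \<comment> \<open>Non-hole positions are counted, because replacing a hole by a variable enlarges
    a context without adding positions.\<close>
  define \<mu> where "\<mu> C = card (poss C - hole_poss C)" for C :: "('f, 'v) ctxt"
  have mono: "poss C - hole_poss C \<subseteq> poss D - hole_poss D" if "C \<sqsubseteq> D" for C D :: "('f, 'v) ctxt"
    using le_poss[OF that] le_subt_at[OF that] by (fastforce simp: hole_poss_iff)
  have \<mu>_less: "\<mu> C < \<mu> D" if "C \<sqsubseteq> D" "C \<noteq> D" for C D
  proof -
    obtain p where "p \<in> hole_poss C" "subt_at D p \<noteq> \<box>" using le_neq_hole[OF \<open>C \<sqsubseteq> D\<close> \<open>C \<noteq> D\<close>] by blast
    then have "p \<in> poss D - hole_poss D" "p \<notin> poss C - hole_poss C"
      using le_poss[OF that(1)] by (auto simp: hole_poss_iff)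
    then show ?thesis
      unfolding \<mu>_def using mono[OF that(1)] by (intro psubset_card_mono) (auto simp: finite_poss)
  qed
  have \<mu>_le: "\<mu> C \<le> \<mu> D" if "C \<sqsubseteq> D" for C D
    using \<mu>_less[OF that] by (cases "C = D") auto
  obtain L0 where L0: "L0 \<in> \<LL>" "L0 \<sqsubseteq> s" "L0 \<noteq> \<box>" using ex_top[OF assms] by blast
  define P where "P L \<longleftrightarrow> L \<in> \<LL> \<and> L \<sqsubseteq> s" for L
  have "P L0" using L0 by (simp add: P_def)
  moreover have "\<forall>L. P L \<longrightarrow> \<mu> L < Suc (\<mu> s)" using \<mu>_le by (auto simp: P_def less_Suc_eq_le)
  ultimately obtain M where M: "P M" "\<And>L. P L \<Longrightarrow> \<mu> L \<le> \<mu> M"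
    by (metis ex_has_greatest_nat)
  then have M\<LL>: "M \<in> \<LL>" and Ms: "M \<sqsubseteq> s" by (auto simp: P_def)
  have "M \<noteq> \<box>"
  proof
    assume "M = \<box>"
    then have "\<mu> M < \<mu> L0" using \<mu>_less[of M L0] L0 by (auto intro: ctxt_le.hole)
    then show False using M(2)[OF \<open>P L0\<close>] by simp
  qed
  have "L \<sqsubseteq> M" if L: "L \<in> \<LL>" "L \<sqsubseteq> s" for L
  proof (cases M)
    case (Var x)
    then show ?thesis using Ms L by auto
  next
    case (Fun f cs)
    then have root: "[] \<in> fun_poss M" by (simp add: fun_poss_iff)
    obtain E where E: "E \<sqsubseteq> s" "M \<sqsubseteq> E" "L \<sqsubseteq> E" "E \<in> \<LL>"
      using LL_lub[OF M\<LL> L(1) root _ L(2)] Ms terms_ctxts[OF assms] by auto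
    then have "\<mu> E \<le> \<mu> M" using M(2) by (simp add: P_def)
    then have "M = E" using \<mu>_less[OF E(2)] by force
    then show ?thesis using E by simp
  qed (use \<open>M \<noteq> \<box>\<close> in simp)
  with that M\<LL> Ms show ?thesis by blast
qed

lemma
  assumes "s \<in> terms F"
  shows is_max_top_max_top: "is_max_top \<LL> s (max_top s)"
    and max_top_greatest: "L \<in> \<LL> \<Longrightarrow> L \<sqsubseteq> s \<Longrightarrow> L \<sqsubseteq> max_top s"
    and max_top_eqI: "is_max_top \<LL> s M \<Longrightarrow> max_top s = M"
proof -
  obtain G where G: "G \<in> \<LL>" "G \<sqsubseteq> s" "\<And>L. L \<in> \<LL> \<Longrightarrow> L \<sqsubseteq> s \<Longrightarrow> L \<sqsubseteq> G"
    using greatest_top_exists[OF assms] by blast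
  then have max: "is_max_top \<LL> s G" by (auto simp: is_max_top_def is_top_def intro: ctxt_le_antisym)
  have uniq: "M = G" if "is_max_top \<LL> s M" for M
    using that G unfolding is_max_top_def is_top_def by metis
  have eq: "max_top s = G" unfolding max_top_def using max uniq by (rule the_equality)
  show "is_max_top \<LL> s (max_top s)" using max by (simp add: eq)
  show "L \<in> \<LL> \<Longrightarrow> L \<sqsubseteq> s \<Longrightarrow> L \<sqsubseteq> max_top s" using G(3) by (simp add: eq)
  show "is_max_top \<LL> s M \<Longrightarrow> max_top s = M" using uniq by (simp add: eq)
qed

lemma
  assumes "s \<in> terms F"
  shows max_top_LL: "max_top s \<in> \<LL>" and max_top_le: "max_top s \<sqsubseteq> s"
    and max_top_not_Hole: "max_top s \<noteq> \<box>"
proof -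
  show "max_top s \<in> \<LL>" "max_top s \<sqsubseteq> s"
    using is_max_top_max_top[OF assms] by (simp_all add: is_max_top_def is_top_def)
  show "max_top s \<noteq> \<box>" using ex_top[OF assms] max_top_greatest[OF assms] by fastforce
qed

text \<open>By (L3) the max-top of the subterm can be merged into the max-top of \<open>t\<close> at
  \<open>p\<close>. The result is a top of \<open>t\<close>, so the merge gains nothing.\<close>

lemma subt_at_max_top_le:
  assumes "t \<in> terms F" "p \<in> fun_poss (max_top t)"
  shows "max_top (subt_at t p) \<sqsubseteq> subt_at (max_top t) p"
proof -
  have p: "p \<in> poss (max_top t)" using assms(2) by (simp add: fun_poss_iff)
  then have pt: "p \<in> poss t" using le_poss max_top_le[OF assms(1)] by blast
  note tp = terms_subt_at[OF assms(1) pt]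
  obtain E where E: "E \<sqsubseteq> subt_at t p" "subt_at (max_top t) p \<sqsubseteq> E" "max_top (subt_at t p) \<sqsubseteq> E"
    "replace_at (max_top t) p E \<in> \<LL>"
    by (rule LL_lub[OF max_top_LL[OF assms(1)] max_top_LL[OF tp] assms(2)
          le_subt_at[OF max_top_le[OF assms(1)] p] max_top_le[OF tp] terms_ctxts[OF tp]])
  have "replace_at (max_top t) p E \<sqsubseteq> max_top t"
    using E(4) by (rule max_top_greatest[OF assms(1)])
      (rule replace_at_le[OF max_top_le[OF assms(1)] p E(1)])
  then have "E \<sqsubseteq> subt_at (max_top t) p" using p le_subt_at poss_replace_at subt_at_replace_at by metis
  then show ?thesis using E(3) ctxt_le.trans by blast
qed

text \<open>This is where (C2) enters: whatever \<open>max_top t\<close> has at \<open>p\<close> can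
  be transplanted into \<open>max_top s\<close> and still gives a top of \<open>s\<close>, as both
  terms agree at \<open>p\<close>. Maximality leaves only the hole.\<close>

lemma subt_at_max_top_hole:
  assumes "s \<in> terms F" "t \<in> terms F" "max_top s \<sqsubseteq> t" "p \<in> hole_poss (max_top s)"
    and "subt_at t p = subt_at s p"
  shows "subt_at (max_top t) p = \<box>"
proof -
  have le: "max_top s \<sqsubseteq> max_top t"
    using max_top_greatest[OF assms(2) max_top_LL[OF assms(1)] assms(3)] .
  have p: "p \<in> poss (max_top s)" using assms(4) by (simp add: hole_poss_iff)
  then have "subt_at (max_top t) p \<sqsubseteq> subt_at s p"
    using le_subt_at[OF max_top_le[OF assms(2)] le_poss[OF le p]] assms(5) by simp
  moreover have "replace_at (max_top s) p (subt_at (max_top t) p) \<in> \<LL>"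
    using LL_replace_hole[OF max_top_LL[OF assms(1)] max_top_LL[OF assms(2)] le assms(4)] .
  ultimately have "replace_at (max_top s) p (subt_at (max_top t) p) \<sqsubseteq> max_top s"
    using max_top_greatest[OF assms(1)] replace_at_le[OF max_top_le[OF assms(1)] p] by blast
  then have "subt_at (max_top t) p \<sqsubseteq> subt_at (max_top s) p"
    using le_subt_at p poss_replace_at subt_at_replace_at by metis
  then show ?thesis using assms(4) by (simp add: hole_poss_iff)
qed

text \<open>Terms of rank at most \<open>n\<close>; recursion on the bound avoids the well-foundedness argument
  that a recursive definition of the rank itself would need.\<close>

primrec rank_le :: "nat \<Rightarrow> ('f, 'v) ctxt set" where
  "rank_le 0 = {}"
| "rank_le (Suc n) = {t \<in> terms F. aliens (max_top t) t \<subseteq> rank_le n}"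

lemma rank_le_terms: "t \<in> rank_le n \<Longrightarrow> t \<in> terms F"
  by (cases n) auto

lemma rank_le_Suc: "rank_le n \<subseteq> rank_le (Suc n)"
proof (induction n)
  case (Suc n)
  then show ?case by auto
qed simp

lemma rank_le_mono: "m \<le> n \<Longrightarrow> rank_le m \<subseteq> rank_le n"
  by (rule lift_Suc_mono_le[of rank_le, OF rank_le_Suc])

text \<open>Since \<open>rank_le 0\<close> is empty, rank at most one means that there are no
  aliens, so the term is its own max-top.\<close>

lemma rank_le_1: "rank_le (Suc 0) = \<LL> \<inter> terms F"
proof (intro set_eqI iffI)
  fix t assume t: "t \<in> rank_le (Suc 0)"
  then have "max_top t = t"
    using le_neq_hole[OF max_top_le[of t]] by (fastforce simp: aliens_def)
  then show "t \<in> \<LL> \<inter> terms F" using t max_top_LL[of t] by simp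
next
  fix t assume t: "t \<in> \<LL> \<inter> terms F"
  then have "max_top t = t"
    using max_top_greatest[of t t] max_top_le[of t] ctxt_le_antisym by (auto intro: ctxt_le.refl)
  then show "t \<in> rank_le (Suc 0)" using t by (auto simp: aliens_def)
qed

lemma rank_exists: "t \<in> terms F \<Longrightarrow> \<exists>n. t \<in> rank_le n"
proof (induction "size t" arbitrary: t rule: less_induct)
  case less
  have "\<exists>n. a \<in> rank_le n" if "a \<in> aliens (max_top t) t" for a
  proof -
    obtain p where p: "p \<in> hole_poss (max_top t)" "a = subt_at t p"
      using \<open>a \<in> _\<close> unfolding aliens_def by blast
    then have "p \<noteq> []" using max_top_not_Hole[OF less.prems] by auto
    moreover have "p \<in> poss t" using p le_poss[OF max_top_le[OF less.prems]] by (auto simp: hole_poss_iff)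
    ultimately show ?thesis
      using less.hyps[of a] p size_subt_at[of p t] terms_subt_at[OF less.prems] by blast
  qed
  then obtain n where n: "\<And>a. a \<in> aliens (max_top t) t \<Longrightarrow> a \<in> rank_le (n a)" by metis
  \<comment> \<open>The sum is a crude common bound for the finitely many aliens.\<close>
  define m where "m = (\<Sum>a \<in> aliens (max_top t) t. n a)"
  have "finite (aliens (max_top t) t)" by (simp add: aliens_def finite_hole_poss)
  then have "n a \<le> m" if "a \<in> aliens (max_top t) t" for a
    using that unfolding m_def by (intro member_le_sum) auto
  then have "t \<in> rank_le (Suc m)" using n rank_le_mono less.prems by fastforce
  then show ?case by blast
qed

text \<open>The max-top of \<open>t\<close> cuts the subterm at least as deep as the subterm's own
  max-top does. Each alien of the subterm is either kept or cut further; in the second case the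
  induction hypothesis at \<open>p @ q\<close> even bounds the rank by one less.\<close>

lemma aliens_subt_at_max_top:
  assumes "t \<in> terms F" "p \<in> poss (max_top t)" "subt_at (max_top t) p \<noteq> \<box>"
    and "subt_at t p \<in> rank_le (Suc n)"
  shows "aliens (subt_at (max_top t) p) (subt_at t p) \<subseteq> rank_le n"
  using assms(2-4)
proof (induction n arbitrary: p)
  case 0
  show ?case
  proof (cases "subt_at (max_top t) p")
    case (Fun f cs)
    then have "p \<in> fun_poss (max_top t)" using 0 by (simp add: fun_poss_iff)
    then have "max_top (subt_at t p) \<sqsubseteq> subt_at (max_top t) p"
      by (rule subt_at_max_top_le[OF assms(1)])
    moreover have "hole_poss (max_top (subt_at t p)) = {}" using 0 by (auto simp: aliens_def)
    ultimately have "hole_poss (subt_at (max_top t) p) = {}" using hole_poss_le_cases by blast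
    then show ?thesis by (simp add: aliens_def)
  qed (use 0 in auto)
next
  case (Suc n)
  show ?case
  proof (cases "subt_at (max_top t) p")
    case (Fun f cs)
    then have "p \<in> fun_poss (max_top t)" using Suc.prems by (simp add: fun_poss_iff)
    then have le: "max_top (subt_at t p) \<sqsubseteq> subt_at (max_top t) p"
      by (rule subt_at_max_top_le[OF assms(1)])
    note Mt = max_top_le[OF assms(1)]
    have "aliens (subt_at (subt_at (max_top t) p) q) (subt_at (subt_at t p) q) \<subseteq> rank_le (Suc n)"
      if q: "q \<in> hole_poss (max_top (subt_at t p))" for q
    proof -
      have alien: "subt_at (subt_at t p) q \<in> rank_le (Suc n)"
        using Suc.prems(3) q by (auto simp: aliens_def)
      have "p @ q \<in> poss (max_top t)"
        using Suc.prems(1) le_poss[OF le] q by (auto simp: poss_append hole_poss_iff)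
      moreover have "subt_at t (p @ q) = subt_at (subt_at t p) q"
        using subt_at_append le_poss[OF Mt] Suc.prems(1) by blast
      ultimately have "subt_at (max_top t) (p @ q) \<noteq> \<box> \<Longrightarrow>
          aliens (subt_at (max_top t) (p @ q)) (subt_at (subt_at t p) q) \<subseteq> rank_le n"
        using Suc.IH[of "p @ q"] alien by simp
      then show ?thesis
        using alien rank_le_Suc[of n] Suc.prems(1)
        by (cases "subt_at (max_top t) (p @ q) = \<box>") (auto simp: subt_at_append)
    qed
    then show ?thesis using aliens_le[OF le le_subt_at[OF Mt Suc.prems(1)]] by blast
  qed (use Suc in auto)
qed

text \<open>A top \<open>N\<close> bounds the rank even if it is not maximal: passing to the max-top
  only refines aliens over \<open>N\<close>. The second claim records that the refined aliens have a
  bound lower by one; this is what excludes new tall aliens.\<close>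

lemma rank_leI:
  assumes "t \<in> terms F" "N \<in> \<LL>" "N \<sqsubseteq> t" "aliens N t \<subseteq> rank_le n"
  shows "t \<in> rank_le (Suc n)"
    and "p \<in> hole_poss (max_top t) \<Longrightarrow> p \<notin> hole_poss N \<Longrightarrow> subt_at t p \<in> rank_le (n - 1)"
proof -
  note Mt = max_top_le[OF assms(1)]
  have le: "N \<sqsubseteq> max_top t" using max_top_greatest assms by blast
  have *: "aliens (subt_at (max_top t) q) (subt_at t q) \<subseteq> rank_le (n - 1)"
    if q: "q \<in> hole_poss N" "subt_at (max_top t) q \<noteq> \<box>" for q
  proof -
    have "q \<in> poss (max_top t)" using le_poss[OF le] q by (simp add: hole_poss_iff)
    moreover have "subt_at t q \<in> rank_le n" using assms(4) q by (auto simp: aliens_def)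
    ultimately show ?thesis using aliens_subt_at_max_top[OF assms(1), of q "n - 1"] q
      by (cases n) auto
  qed
  have new: "subt_at t p \<in> rank_le (n - 1)"
    if p: "p \<in> hole_poss (max_top t)" "p \<notin> hole_poss N" for p
  proof -
    obtain o1 o2 where o: "p = o1 @ o2" "o1 \<in> hole_poss N" "o2 \<in> hole_poss (subt_at (max_top t) o1)"
      by (rule hole_poss_le_cases[OF le p(1)])
    then have "o2 \<noteq> []" using p by auto
    then have "subt_at (max_top t) o1 \<noteq> \<box>" using o by auto
    moreover have "o1 \<in> poss t" using o le_poss assms(3) by (auto simp: hole_poss_iff)
    ultimately show ?thesis using *[OF o(2)] o by (auto simp: aliens_def subt_at_append)
  qed
  show "p \<in> hole_poss (max_top t) \<Longrightarrow> p \<notin> hole_poss N \<Longrightarrow> subt_at t p \<in> rank_le (n - 1)"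
    by (rule new)
  have "aliens (max_top t) t \<subseteq> rank_le n"
    using new assms(4) rank_le_mono[of "n - 1" n] by (fastforce simp: aliens_def)
  then show "t \<in> rank_le (Suc n)" using assms(1) by simp
qed

section \<open>Rewrite steps and max-tops\<close>

lemma aliens_rule:
  assumes "\<rho> \<in> R"
  shows "aliens (snd \<rho> \<cdot> \<tau>) (snd \<rho> \<cdot> \<sigma>) \<subseteq> aliens (fst \<rho> \<cdot> \<tau>) (fst \<rho> \<cdot> \<sigma>)"
  unfolding aliens_subst[OF rule_terms(1)[OF assms]] aliens_subst[OF rule_terms(2)[OF assms]]
  using rule_terms(3)[OF assms] by (intro SUP_subset_mono order_refl)

text \<open>By (W) and (C1) the rule also applies in the max-top, by a match \<open>\<tau>\<close>
  beside the match \<open>\<sigma>\<close> in \<open>s\<close>. A hole as result means that the rule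
  projects to an alien, which forces a root step. The last clause holds for every
  \<open>\<phi>\<close> because the rule sees aliens only through its variables.\<close>

lemma step_in_top:
  assumes "s \<in> terms F" "\<rho> \<in> R" "step_at p \<rho> s t" "p \<in> fun_poss (max_top s)"
  obtains L where "step_at p \<rho> (max_top s) L"
    "L = max_top t \<or> L = \<box> \<and> p = [] \<and> t \<in> aliens (max_top s) s"
    "aliens L t \<subseteq> aliens (max_top s) s"
    "\<And>\<phi>. step_at p \<rho> (map_aliens \<phi> (max_top s) s) (map_aliens \<phi> L t)"
proof -
  note M = max_top_le[OF assms(1)]
  have p: "p \<in> poss (max_top s)" using assms(4) by (simp add: fun_poss_iff)
  obtain \<sigma> where \<sigma>: "subt_at s p = fst \<rho> \<cdot> \<sigma>" "t = replace_at s p (snd \<rho> \<cdot> \<sigma>)"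
    using assms(3) unfolding step_at_def by blast
  obtain L where L: "L \<in> \<LL>" "step_at p \<rho> (max_top s) L"
    using layered assms is_max_top_max_top[OF assms(1)] unfolding layered_def W_def by blast
  then obtain \<tau> where \<tau>: "subt_at (max_top s) p = fst \<rho> \<cdot> \<tau>"
      "L = replace_at (max_top s) p (snd \<rho> \<cdot> \<tau>)"
    unfolding step_at_def by blast
  have "is_max_top \<LL> t L \<or> L = \<box>"
    using layered assms is_max_top_max_top[OF assms(1)] L unfolding layered_def C1_def by blast
  then have top: "L = max_top t \<or> L = \<box>"
    using max_top_eqI[OF step_at_terms[OF assms(2,3,1)]] by blast
  have "aliens (snd \<rho> \<cdot> \<tau>) (snd \<rho> \<cdot> \<sigma>) \<subseteq> aliens (fst \<rho> \<cdot> \<tau>) (fst \<rho> \<cdot> \<sigma>)"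
    by (rule aliens_rule[OF assms(2)])
  also have "\<dots> \<subseteq> aliens (max_top s) s" using aliens_subt_at[OF p M] \<sigma> \<tau> by metis
  finally have aliens: "aliens L t \<subseteq> aliens (max_top s) s"
    using aliens_replace_at[OF p M] \<sigma> \<tau> by fastforce
  have "L = \<box> \<Longrightarrow> p = [] \<and> t \<in> aliens (max_top s) s"
    using aliens \<tau>(2) replace_at_eq_Hole[OF p] by auto
  moreover have "step_at p \<rho> (map_aliens \<phi> (max_top s) s) (map_aliens \<phi> L t)" for \<phi>
  proof -
    have "p \<in> poss (map_aliens \<phi> (max_top s) s)"
      using le_poss[OF le_fill p] by (simp add: map_aliens_def)
    moreover have "subt_at (map_aliens \<phi> (max_top s) s) p =
        fst \<rho> \<cdot> (\<lambda>z. map_aliens \<phi> (\<tau> z) (\<sigma> z))"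
      using subt_at_map_aliens[OF p M] map_aliens_subst[OF rule_terms(1)[OF assms(2)]] \<sigma>(1) \<tau>(1)
      by simp
    moreover have "map_aliens \<phi> L t = replace_at (map_aliens \<phi> (max_top s) s) p
        (snd \<rho> \<cdot> (\<lambda>z. map_aliens \<phi> (\<tau> z) (\<sigma> z)))"
      using map_aliens_replace_at[OF p M] map_aliens_subst[OF rule_terms(2)[OF assms(2)]] \<sigma>(2) \<tau>(2)
      by simp
    ultimately show ?thesis unfolding step_at_def by blast
  qed
  ultimately show ?thesis using that L(2) top aliens by blast
qed

text \<open>Left-hand sides are not variables, so a redex sits at a function position of
  \<open>C\<close> or below a hole. In the latter case the step leaves \<open>C\<close>
  intact.\<close>

lemma step_cases:
  assumes "s \<in> terms F" "\<rho> \<in> R" "step_at p \<rho> s t" "C \<sqsubseteq> s"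
  obtains "p \<in> fun_poss C"
  | q p' u where "p = q @ p'" "q \<in> hole_poss C" "step_at p' \<rho> (subt_at s q) u"
      "t = replace_at s q u" "C \<sqsubseteq> t"
proof -
  have p: "p \<in> fun_poss s" using step_at_fun_poss[OF assms(2,3)] .
  then have "p \<in> poss s" by (simp add: fun_poss_iff)
  from assms(4) this show ?thesis
  proof (cases rule: poss_le_cases)
    case 1
    obtain f ts where "subt_at s p = Fun f ts" using p by (auto simp: fun_poss_iff)
    then have "\<exists>f ts. subt_at C p = Fun f ts"
      using le_subt_at[OF assms(4) 1(1)] 1(2) by (auto simp: le_Fun)
    then show ?thesis using that(1) 1 by (simp add: fun_poss_iff)
  next
    case (2 q p')
    then show ?thesis
      using that(2) assms(3) le_replace_at_hole[OF assms(4)] unfolding \<open>p = q @ p'\<close> step_at_append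
      by blast
  qed
qed

text \<open>A step at a function position of the max-top creates no aliens or collapses to an
  existing one. A step inside an alien keeps the old max-top as a top, which suffices by
  \<open>rank_leI\<close>.\<close>

lemma rank_le_step:
  assumes "\<rho> \<in> R" "step_at p \<rho> s t" "s \<in> rank_le n"
  shows "t \<in> rank_le n"
  using assms(2,3)
proof (induction n arbitrary: s t p)
  case (Suc n)
  note s = rank_le_terms[OF Suc.prems(2)]
  note t = step_at_terms[OF assms(1) Suc.prems(1) s]
  show ?case
  proof (cases rule: step_cases[OF s assms(1) Suc.prems(1) max_top_le[OF s]])
    case 1
    obtain L where "L = max_top t \<or> L = \<box> \<and> p = [] \<and> t \<in> aliens (max_top s) s"
      "aliens L t \<subseteq> aliens (max_top s) s"
      using step_in_top[OF s assms(1) Suc.prems(1) 1] by blast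
    then show ?thesis using Suc.prems(2) t rank_le_Suc[of n] by auto
  next
    case (2 q p' u)
    have q: "q \<in> poss s" using 2 le_poss[OF max_top_le[OF s]] by (auto simp: hole_poss_iff)
    have "subt_at t q' \<in> rank_le n" if q': "q' \<in> hole_poss (max_top s)" for q'
    proof (cases "q' = q")
      case True
      then show ?thesis using Suc.IH[OF 2(3)] Suc.prems(2) 2(2,4) q by (auto simp: aliens_def)
    next
      case False
      then have "subt_at t q' = subt_at s q'"
        using replace_at_parallel(2)[OF q hole_poss_parallel[OF 2(2) q']] q' 2(4)
          le_poss[OF max_top_le[OF s]] by (auto simp: hole_poss_iff)
      then show ?thesis using Suc.prems(2) q' by (auto simp: aliens_def)
    qed
    then show ?thesis
      using rank_leI(1)[OF t max_top_LL[OF s] 2(5)] by (auto simp: aliens_def)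
  qed
qed simp

lemma rank_le_steps: "(rstep R)\<^sup>*\<^sup>* s t \<Longrightarrow> s \<in> rank_le n \<Longrightarrow> t \<in> rank_le n"
  by (induction rule: rtranclp_induct) (auto simp: rstep_def intro: rank_le_step)

subsection \<open>Short steps\<close>

abbreviation steps :: "('f, 'v) ctxt \<Rightarrow> ('f, 'v) ctxt \<Rightarrow> bool" where
  "steps \<equiv> (rstep R)\<^sup>*\<^sup>*"

definition confluent_rank :: "nat \<Rightarrow> bool" where
  "confluent_rank n \<longleftrightarrow> (\<forall>s \<in> rank_le n. \<forall>t u. steps s t \<and> steps s u \<longrightarrow> (\<exists>v. steps t v \<and> steps u v))"

definition tall_poss :: "nat \<Rightarrow> ('f, 'v) ctxt \<Rightarrow> nat list set" where
  "tall_poss k s = {p \<in> hole_poss (max_top s). subt_at s p \<notin> rank_le k}"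

definition tall_aliens :: "nat \<Rightarrow> ('f, 'v) ctxt \<Rightarrow> ('f, 'v) ctxt set" where
  "tall_aliens k s = aliens (max_top s) s - rank_le k"

lemma tall_aliens_eq: "tall_aliens k s = subt_at s ` tall_poss k s"
  by (auto simp: tall_aliens_def tall_poss_def aliens_def)

lemma finite_tall_poss: "finite (tall_poss k s)"
  by (simp add: tall_poss_def finite_hole_poss)

lemma tall_poss_empty: "s \<in> rank_le (Suc k) \<Longrightarrow> tall_poss k s = {}"
  by (auto simp: tall_poss_def aliens_def)

text \<open>Both steps in the max-top and steps inside aliens of rank at most \<open>k\<close> are
  short.\<close>

definition short_step :: "nat \<Rightarrow> ('f, 'v) ctxt \<Rightarrow> ('f, 'v) ctxt \<Rightarrow> bool" where
  "short_step k s t \<longleftrightarrow> s \<in> rank_le (Suc (Suc k)) \<and>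
    (\<exists>p. \<exists>\<rho> \<in> R. step_at p \<rho> s t \<and> (\<forall>q \<in> tall_poss k s. \<forall>p'. p \<noteq> q @ p'))"

text \<open>Indexed by positions, since equal aliens may reduce differently. The reductions may be
  empty.\<close>

definition reducts :: "nat \<Rightarrow> ('f, 'v) ctxt \<Rightarrow> (nat list \<Rightarrow> ('f, 'v) ctxt) \<Rightarrow> bool" where
  "reducts k s b \<longleftrightarrow> (\<forall>p \<in> hole_poss (max_top s).
    steps (subt_at s p) (b p) \<and> (subt_at s p \<in> rank_le k \<longrightarrow> b p = subt_at s p))"

text \<open>The result is written over the max-top of \<open>s\<close>, which may be smaller than
  that of \<open>t\<close>.\<close>

definition tall_step :: "nat \<Rightarrow> nat \<Rightarrow> ('f, 'v) ctxt \<Rightarrow> ('f, 'v) ctxt \<Rightarrow> bool" where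
  "tall_step k n s t \<longleftrightarrow> s \<in> rank_le (Suc (Suc k)) \<and>
    (\<exists>b. reducts k s b \<and> t = fill (max_top s) b \<and> n = card (b ` tall_poss k s))"

abbreviation hat :: "(('f, 'v) ctxt \<Rightarrow> ('f, 'v) ctxt) \<Rightarrow> ('f, 'v) ctxt \<Rightarrow> ('f, 'v) ctxt" where
  "hat \<phi> s \<equiv> map_aliens \<phi> (max_top s) s"

lemma short_step_rstep: "short_step k s t \<Longrightarrow> rstep R s t"
  by (auto simp: short_step_def rstep_def)

lemma steps_short_step:
  assumes "steps s t" "s \<in> rank_le (Suc k)"
  shows "(short_step k)\<^sup>*\<^sup>* s t"
  using assms
proof (induction rule: rtranclp_induct)
  case (step t u)
  have t: "t \<in> rank_le (Suc k)" using rank_le_steps step by blast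
  then have "t \<in> rank_le (Suc (Suc k))" using rank_le_Suc by blast
  then have "short_step k t u"
    using step.hyps(2) tall_poss_empty[OF t] by (auto simp: rstep_def short_step_def)
  then show ?case using step by auto
qed simp

lemma aliens_rank_le: "s \<in> rank_le (Suc k) \<Longrightarrow> aliens (max_top s) s \<subseteq> rank_le k"
  by simp

lemma alien_rank_le:
  "s \<in> rank_le (Suc k) \<Longrightarrow> p \<in> hole_poss (max_top s) \<Longrightarrow> subt_at s p \<in> rank_le k"
  by (auto simp: aliens_def)

lemma hole_poss_max_top_poss: "s \<in> terms F \<Longrightarrow> p \<in> hole_poss (max_top s) \<Longrightarrow> p \<in> poss s"
  using le_poss[OF max_top_le] by (auto simp: hole_poss_iff)

lemma hat_id:
  assumes "s \<in> rank_le (Suc k)" "\<And>a. a \<in> rank_le k \<Longrightarrow> \<phi> a = a"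
  shows "hat \<phi> s = s"
  by (rule map_aliens_id) (use assms max_top_le in auto)

text \<open>The second alternative is a collapsing step, whose result is one of the tall aliens.\<close>

lemma short_step_hat:
  assumes s: "s \<in> rank_le (Suc (Suc k))" and \<rho>: "\<rho> \<in> R" and step: "step_at p \<rho> s t"
    and short: "\<And>q p'. q \<in> tall_poss k s \<Longrightarrow> p \<noteq> q @ p'"
    and \<phi>: "\<And>a. a \<in> rank_le k \<Longrightarrow> \<phi> a = a"
  obtains u where "step_at p \<rho> (hat \<phi> s) u"
    "u = hat \<phi> t \<and> tall_aliens k t \<subseteq> tall_aliens k s \<or> u = \<phi> t \<and> t \<in> tall_aliens k s"
proof -
  note sT = rank_le_terms[OF s]
  note tT = step_at_terms[OF \<rho> step sT]
  let ?M = "max_top s" and ?N = "max_top t"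
  show ?thesis
  proof (cases rule: step_cases[OF sT \<rho> step max_top_le[OF sT]])
    case 1
    obtain L where L: "L = ?N \<or> L = \<box> \<and> p = [] \<and> t \<in> aliens ?M s"
      "aliens L t \<subseteq> aliens ?M s" "step_at p \<rho> (hat \<phi> s) (map_aliens \<phi> L t)"
      using step_in_top[OF sT \<rho> step 1] by metis
    show ?thesis
    proof (cases "L = ?N")
      case True
      then show ?thesis using that[of "hat \<phi> t"] L by (auto simp: tall_aliens_def)
    next
      case False
      then have t: "L = \<box>" "t \<in> aliens ?M s" using L(1) by auto
      show ?thesis
      \<comment> \<open>A collapse to an alien of low rank fits the first alternative:
        \<open>t\<close> then has no tall aliens and is fixed by \<open>hat \<phi>\<close>.\<close>
      proof (cases "t \<in> rank_le k")
        case True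
        then have t1: "t \<in> rank_le (Suc k)" using rank_le_Suc by blast
        have "tall_aliens k t = {}" using tall_poss_empty[OF t1] by (simp add: tall_aliens_eq)
        then show ?thesis using that[of "\<phi> t"] L(3) t hat_id[OF t1, of \<phi>] \<phi> True by auto
      next
        case False
        then show ?thesis using that[of "\<phi> t"] L(3) t by (auto simp: tall_aliens_def)
      qed
    qed
  next
    case (2 q p' u)
    have qs: "q \<in> poss s" by (rule hole_poss_max_top_poss[OF sT 2(2)])
    have sq: "subt_at s q \<in> rank_le k" using short[of q p'] 2(1,2) by (auto simp: tall_poss_def)
    have tq: "subt_at t q = u" using 2(4) qs by simp
    \<comment> \<open>Weakened to \<open>Suc k\<close> because \<open>aliens_subt_at_max_top\<close>
      takes one off again.\<close>
    have u: "u \<in> rank_le (Suc k)" using rank_le_step[OF \<rho> 2(3) sq] rank_le_Suc by blast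
    have le: "?M \<sqsubseteq> ?N" using max_top_greatest[OF tT max_top_LL[OF sT] 2(5)] .
    have qN: "q \<in> poss ?N" using le_poss[OF le] 2(2) by (simp add: hole_poss_iff)
    \<comment> \<open>By (C2) the max-top can grow only at \<open>q\<close>, where the step took
      place.\<close>
    have other: "subt_at t q' = subt_at s q'" "subt_at ?N q' = \<box>"
      if q': "q' \<in> hole_poss ?M" "q' \<noteq> q" for q'
    proof -
      show eq: "subt_at t q' = subt_at s q'"
        using replace_at_parallel(2)[OF qs hole_poss_parallel[OF 2(2) q'(1)]] q' 2(4)
          hole_poss_max_top_poss[OF sT] by auto
      show "subt_at ?N q' = \<box>" using subt_at_max_top_hole[OF sT tT 2(5) q'(1) eq] .
    qed
    have at_q: "aliens (subt_at ?N q) u \<subseteq> rank_le k"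
      using aliens_subt_at_max_top[OF tT qN] tq u rank_le_step[OF \<rho> 2(3) sq]
      by (cases "subt_at ?N q = \<box>") auto
    have "tall_aliens k t \<subseteq> tall_aliens k s"
    proof -
      have "aliens (subt_at ?N q') (subt_at t q') \<subseteq> aliens ?M s \<union> rank_le k" if "q' \<in> hole_poss ?M" for q'
        using that other[of q'] at_q tq by (cases "q' = q") (auto simp: aliens_def)
      then show ?thesis unfolding tall_aliens_def aliens_le[OF le max_top_le[OF tT]] by blast
    qed
    moreover have "hat \<phi> t = replace_at (hat \<phi> s) q u"
    proof -
      have "subt_at ?N q \<sqsubseteq> u" using le_subt_at[OF max_top_le[OF tT] qN] tq by simp
      then have "map_aliens \<phi> (subt_at ?N q) u = u"
        by (rule map_aliens_id) (use at_q \<phi> in blast)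
      then show ?thesis
        unfolding map_aliens_le[OF le max_top_le[OF tT]] map_aliens_def[of \<phi> ?M] replace_at_fill[OF 2(2)]
        by (intro fill_cong) (auto simp: other tq)
    qed
    moreover have "step_at p \<rho> (hat \<phi> s) (replace_at (hat \<phi> s) q u)"
    proof -
      have "q \<in> poss (hat \<phi> s)" using 2(2) le_poss[OF le_fill] by (auto simp: map_aliens_def hole_poss_iff)
      moreover have "subt_at (hat \<phi> s) q = subt_at s q"
        using \<phi>[OF sq] by (simp add: map_aliens_def subt_at_fill_hole[OF 2(2)])
      ultimately show ?thesis unfolding 2(1) step_at_append using 2(3) by auto
    qed
    ultimately show ?thesis using that[of "hat \<phi> t"] by simp
  qed
qed

text \<open>(L2) trades one hole for one variable, so the holes are treated one after
  another.\<close>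

lemma LL_fill_Var:
  assumes "C \<in> \<LL>"
  shows "fill C (\<lambda>p. if P p then Var (x p) else \<box>) \<in> \<LL>"
proof -
  have "fill C (\<lambda>p. if p \<in> Q then Var (x p) else \<box>) \<in> \<LL>" if "finite Q" "Q \<subseteq> hole_poss C" for Q
    using that
  proof (induction Q)
    case empty
    have "fill C (\<lambda>p. \<box>) = fill C (subt_at C)"
      by (rule fill_cong) (simp add: hole_poss_iff)
    then show ?case using assms by (simp add: ctxt_le.refl)
  next
    case (insert q Q)
    let ?b = "\<lambda>p. if p \<in> Q then Var (x p) else \<box>"
    have q: "q \<in> hole_poss C" and IH: "fill C ?b \<in> \<LL>" using insert by auto
    have "replace_at (fill C ?b) q \<box> = fill C ?b"
      unfolding replace_at_fill[OF q] using insert.hyps(2) by (intro fill_cong) auto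
    then have "replace_at (fill C ?b) q \<box> \<in> \<LL>" using IH by simp
    then have "replace_at (fill C ?b) q (Var (x q)) \<in> \<LL>"
      using LL_replace_Var[OF LL_ctxts[OF IH] poss_fill[OF q]] by blast
    moreover have "replace_at (fill C ?b) q (Var (x q)) =
        fill C (\<lambda>p. if p \<in> insert q Q then Var (x p) else \<box>)"
      unfolding replace_at_fill[OF q] by (intro fill_cong) auto
    ultimately show ?case by simp
  qed
  from this[of "{p \<in> hole_poss C. P p}"] show ?thesis
    using fill_cong[of C "\<lambda>p. if p \<in> {p \<in> hole_poss C. P p} then Var (x p) else \<box>"
        "\<lambda>p. if P p then Var (x p) else \<box>"]
    by (simp add: finite_hole_poss)
qed

text \<open>\<open>N\<close> is the max-top with variables in the holes that carry members of
  \<open>A\<close>. It is a top of the new term, perhaps not the greatest, and its aliens are the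
  original ones outside \<open>A\<close>, of rank at most \<open>k\<close>.\<close>

lemma hat_rank_le:
  assumes s: "s \<in> rank_le (Suc (Suc k))" and "tall_aliens k s \<subseteq> A"
  shows "hat (\<lambda>a. if a \<in> A then Var (x a) else a) s \<in> rank_le (Suc k)"
proof -
  note sT = rank_le_terms[OF s]
  let ?M = "max_top s" and ?\<phi> = "\<lambda>a. if a \<in> A then Var (x a) else a"
  define N where "N = fill ?M (\<lambda>p. if subt_at s p \<in> A then Var (x (subt_at s p)) else \<box>)"
  have "hat ?\<phi> s \<in> terms F"
    unfolding map_aliens_def
    using terms_subt_at[OF sT hole_poss_max_top_poss[OF sT]] LL_ctxts[OF max_top_LL[OF sT]]
    by (intro terms_fill) auto
  moreover have "N \<in> \<LL>" unfolding N_def by (rule LL_fill_Var[OF max_top_LL[OF sT]])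
  moreover have "N \<sqsubseteq> hat ?\<phi> s"
    unfolding N_def map_aliens_def by (rule fill_mono) (auto intro: ctxt_le.hole)
  moreover have "aliens N (hat ?\<phi> s) \<subseteq> rank_le k"
  proof -
    have "subt_at (hat ?\<phi> s) p \<in> rank_le k" if p: "p \<in> hole_poss N" for p
    proof -
      have "?M \<sqsubseteq> N" unfolding N_def by (rule le_fill)
      from this p obtain o1 o2 where o: "p = o1 @ o2" "o1 \<in> hole_poss ?M" "o2 \<in> hole_poss (subt_at N o1)"
        by (rule hole_poss_le_cases)
      moreover have "subt_at N o1 = (if subt_at s o1 \<in> A then Var (x (subt_at s o1)) else \<box>)"
        unfolding N_def using o(2) by (rule subt_at_fill_hole)
      ultimately have "subt_at s o1 \<notin> A" "p = o1" by (auto split: if_splits)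
      then show ?thesis
        using o(2) assms(2)
        by (auto simp: map_aliens_def subt_at_fill_hole tall_aliens_def aliens_def)
    qed
    then show ?thesis by (auto simp: aliens_def)
  qed
  ultimately show ?thesis by (rule rank_leI(1))
qed

text \<open>Short reductions are simulated on \<open>hat \<phi> s\<close>, joined there, and
  translated back by \<open>\<sigma>\<close>. If a step collapses to a tall alien \<open>a\<close>,
  the simulation stops at the normal form \<open>Var (\<nu> a)\<close>, and the original reduction
  continues from \<open>a\<close>.\<close>

lemma short_step_confluent:
  assumes inf: "infinite (UNIV :: 'v set)" and CR: "confluent_rank (Suc k)"
    and "(short_step k)\<^sup>*\<^sup>* s t1" "(short_step k)\<^sup>*\<^sup>* s t2"
  shows "\<exists>v. (short_step k)\<^sup>*\<^sup>* t1 v \<and> (short_step k)\<^sup>*\<^sup>* t2 v"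
proof (cases "s \<in> rank_le (Suc (Suc k))")
  case False
  then have "\<not> short_step k s u" for u by (simp add: short_step_def del: rank_le.simps)
  then have "t1 = s" "t2 = s" using assms(3,4) by (auto elim: converse_rtranclpE)
  then show ?thesis by blast
next
  case s: True
  define A where "A = tall_aliens k s"
  have "finite A" by (simp add: A_def tall_aliens_eq finite_tall_poss)
  \<comment> \<open>Freshness for \<open>s\<close> is enough, as rewriting introduces no
    variables.\<close>
  have "infinite (UNIV - vars s)" using inf finite_vars by (rule Diff_infinite_finite[rotated])
  then obtain B where B: "finite B" "card B = card A" "B \<subseteq> UNIV - vars s"
    using infinite_arbitrarily_large by blast
  \<comment> \<open>Distinct aliens get distinct variables, so that \<open>\<sigma>\<close> can undo
    the replacement.\<close>
  obtain \<nu> where \<nu>: "bij_betw \<nu> A B" using finite_same_card_bij[OF \<open>finite A\<close> B(1) B(2)[symmetric]] by blast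
  define \<phi> where "\<phi> a = (if a \<in> A then Var (\<nu> a) else a)" for a
  define \<sigma> where "\<sigma> x = (if x \<in> B then inv_into A \<nu> x else Var x)" for x
  have \<phi>_id: "\<phi> a = a" if "a \<in> rank_le k" for a
    using that by (auto simp: \<phi>_def A_def tall_aliens_def)
  have \<sigma>_\<nu>: "\<sigma> (\<nu> a) = a" if "a \<in> A" for a
    using that \<nu> by (auto simp: \<sigma>_def bij_betw_def)
  have \<sigma>_id: "\<sigma> x = Var x" if "x \<in> vars s" for x
    using that B by (auto simp: \<sigma>_def)
  have A_rank: "a \<in> rank_le (Suc k)" if "a \<in> A" for a
    using that aliens_rank_le[OF s] by (auto simp: A_def tall_aliens_def)
  \<comment> \<open>Invariant of the simulation: \<open>A\<close> keeps covering the tall aliens,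
    and the variables in \<open>B\<close> stay fresh.\<close>
  define ok where "ok t \<longleftrightarrow> t \<in> rank_le (Suc (Suc k)) \<and> tall_aliens k t \<subseteq> A \<and> vars t \<subseteq> vars s" for t
  have hat_\<sigma>: "hat \<phi> t \<cdot> \<sigma> = t" if "ok t" for t
  proof -
    have tT: "t \<in> terms F" using that rank_le_terms by (auto simp: ok_def)
    have vt: "vars t \<subseteq> vars s" using that by (simp add: ok_def)
    have "\<phi> a \<cdot> \<sigma> = a" if "vars a \<subseteq> vars s" for a
      using that \<sigma>_\<nu> by (auto simp: \<phi>_def intro!: subst_Var \<sigma>_id)
    then have "\<phi> (subt_at t p) \<cdot> \<sigma> = subt_at t p" if "p \<in> hole_poss (max_top t)" for p
      using vt vars_subt_at[OF hole_poss_max_top_poss[OF tT that]] by blast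
    then have "fill (max_top t) (\<lambda>p. \<phi> (subt_at t p) \<cdot> \<sigma>) = fill (max_top t) (subt_at t)"
      by (rule fill_cong)
    moreover have "\<sigma> x = Var x" if "x \<in> vars (max_top t)" for x
      using that vars_le[OF max_top_le[OF tT]] vt \<sigma>_id by blast
    ultimately show ?thesis
      using max_top_le[OF tT] by (simp add: map_aliens_def subst_fill)
  qed
  have no_Var: "\<not> rstep R (Var x) u" for x u
    using step_at_fun_poss by (fastforce simp: rstep_def fun_poss_iff)
  have ok_step: "(\<exists>u. step_at p \<rho> (hat \<phi> t) u \<and> (u = hat \<phi> t' \<and> ok t' \<or> t' \<in> A \<and> u = Var (\<nu> t')))"
    if t: "ok t" and \<rho>: "\<rho> \<in> R" and step: "step_at p \<rho> t t'"
      and short: "\<And>q p'. q \<in> tall_poss k t \<Longrightarrow> p \<noteq> q @ p'" for p \<rho> t t'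
  proof -
    have tr: "t \<in> rank_le (Suc (Suc k))" using t by (simp add: ok_def)
    obtain u where u: "step_at p \<rho> (hat \<phi> t) u"
      "u = hat \<phi> t' \<and> tall_aliens k t' \<subseteq> tall_aliens k t \<or> u = \<phi> t' \<and> t' \<in> tall_aliens k t"
      using short_step_hat[OF tr \<rho> step short \<phi>_id] by blast
    moreover have "t' \<in> rank_le (Suc (Suc k))" "vars t' \<subseteq> vars t"
      using rank_le_step[OF \<rho> step tr] step_at_vars[OF \<rho> step] .
    moreover have "tall_aliens k t \<subseteq> A" "vars t \<subseteq> vars s" using t by (simp_all add: ok_def)
    ultimately show ?thesis unfolding ok_def \<phi>_def[of t'] by (metis order_trans subsetD)
  qed
  have forward: "steps (hat \<phi> s) (hat \<phi> t) \<and> ok t \<or> (\<exists>a \<in> A. steps (hat \<phi> s) (Var (\<nu> a)) \<and> steps a t)"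
    if "(short_step k)\<^sup>*\<^sup>* s t" for t
    using that
  proof (induction rule: rtranclp_induct)
    case base
    then show ?case using s by (simp add: ok_def A_def)
  next
    case (step t t')
    from step.IH show ?case
    proof
      assume IH: "steps (hat \<phi> s) (hat \<phi> t) \<and> ok t"
      obtain p \<rho> where p: "\<rho> \<in> R" "step_at p \<rho> t t'" "\<And>q p'. q \<in> tall_poss k t \<Longrightarrow> p \<noteq> q @ p'"
        using step.hyps(2) unfolding short_step_def by blast
      obtain u where u: "step_at p \<rho> (hat \<phi> t) u" "u = hat \<phi> t' \<and> ok t' \<or> t' \<in> A \<and> u = Var (\<nu> t')"
        using ok_step[OF conjunct2[OF IH] p] by blast
      then have "steps (hat \<phi> s) u"
        using IH p(1) by (meson rstep_def rtranclp.rtrancl_into_rtrancl)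
      then show ?thesis using u(2) by blast
    next
      assume "\<exists>a \<in> A. steps (hat \<phi> s) (Var (\<nu> a)) \<and> steps a t"
      then show ?thesis
        using short_step_rstep[OF step.hyps(2)] by (meson rtranclp.rtrancl_into_rtrancl)
    qed
  qed
  have backward: "(short_step k)\<^sup>*\<^sup>* t (e \<cdot> \<sigma>) \<and> (e = hat \<phi> (e \<cdot> \<sigma>) \<and> ok (e \<cdot> \<sigma>) \<or> (\<exists>a \<in> A. e = Var (\<nu> a)))"
    if "steps (hat \<phi> t) e" and t: "ok t" for t e
    using that(1)
  proof (induction rule: rtranclp_induct)
    case base
    then show ?case using t hat_\<sigma>[OF t] by simp
  next
    case (step e e')
    let ?v = "e \<cdot> \<sigma>"
    have v: "e = hat \<phi> ?v" "ok ?v" using step.IH step.hyps(2) no_Var by blast+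
    then have vr: "?v \<in> rank_le (Suc (Suc k))" and vA: "tall_aliens k ?v \<subseteq> A" by (simp_all add: ok_def)
    obtain p \<rho> where p: "\<rho> \<in> R" "step_at p \<rho> e e'" using step.hyps(2) by (auto simp: rstep_def)
    have step': "step_at p \<rho> ?v (e' \<cdot> \<sigma>)" using step_at_subst[OF p(2)] .
    \<comment> \<open>Seen from \<open>e\<close>, such a step would rewrite a variable.\<close>
    have short: "p \<noteq> q @ p'" if q: "q \<in> tall_poss k ?v" for q p'
    proof
      assume "p = q @ p'"
      have qM: "q \<in> hole_poss (max_top ?v)" using q by (simp add: tall_poss_def)
      have "subt_at ?v q \<in> A" using q vA by (auto simp: tall_aliens_eq)
      then have "subt_at (hat \<phi> ?v) q = Var (\<nu> (subt_at ?v q))"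
        by (simp add: map_aliens_def subt_at_fill_hole[OF qM] \<phi>_def)
      then have "subt_at e q = Var (\<nu> (subt_at ?v q))" using v(1) by simp
      moreover have "rstep R (subt_at e q) u" if "step_at p' \<rho> (subt_at e q) u" for u
        using that p(1) by (auto simp: rstep_def)
      ultimately show False
        using p(2) no_Var unfolding \<open>p = q @ p'\<close> step_at_append by metis
    qed
    have "short_step k ?v (e' \<cdot> \<sigma>)" using vr p(1) step' short by (auto simp: short_step_def)
    moreover obtain u where u: "step_at p \<rho> (hat \<phi> ?v) u"
      "u = hat \<phi> (e' \<cdot> \<sigma>) \<and> ok (e' \<cdot> \<sigma>) \<or> e' \<cdot> \<sigma> \<in> A \<and> u = Var (\<nu> (e' \<cdot> \<sigma>))"
      using ok_step[OF v(2) p(1) step' short] by blast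
    moreover have "u = e'"
      using step_at_det[OF rule_terms(3)[OF p(1)] u(1)] p(2) v(1) by simp
    ultimately show ?case using step.IH by (meson rtranclp.rtrancl_into_rtrancl)
  qed
  have Var_steps: "e = Var x" if "steps (Var x) e" for x e
    using that no_Var by (auto elim: converse_rtranclpE)
  have hat_s: "hat \<phi> s \<in> rank_le (Suc k)"
    using hat_rank_le[OF s, of A \<nu>] unfolding A_def \<phi>_def[abs_def] by simp
  have join: "\<exists>e. steps x e \<and> steps y e" if "steps (hat \<phi> s) x" "steps (hat \<phi> s) y" for x y
    using CR hat_s that unfolding confluent_rank_def by blast
  \<comment> \<open>As \<open>Var (\<nu> a)\<close> is a normal form, joining forces
    \<open>hat \<phi> t\<close> to reduce to it; translated back, \<open>t\<close> reaches
    \<open>a\<close>, and from there \<open>t'\<close>.\<close>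
  have collapse: "\<exists>v. (short_step k)\<^sup>*\<^sup>* t v \<and> (short_step k)\<^sup>*\<^sup>* t' v"
    if t: "steps (hat \<phi> s) (hat \<phi> t)" "ok t" and a: "a \<in> A" "steps (hat \<phi> s) (Var (\<nu> a))" "steps a t'"
    for t t' a
  proof -
    have "steps (hat \<phi> t) (Var (\<nu> a))" using join[OF t(1) a(2)] Var_steps by blast
    then have "(short_step k)\<^sup>*\<^sup>* t a" using backward[OF _ t(2)] \<sigma>_\<nu>[OF a(1)] by fastforce
    moreover have "(short_step k)\<^sup>*\<^sup>* a t'" using steps_short_step[OF a(3) A_rank[OF a(1)]] .
    ultimately show ?thesis by (meson rtranclp.rtrancl_refl rtranclp_trans)
  qed
  from forward[OF assms(3)] forward[OF assms(4)] show ?thesis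
  proof (elim disjE conjE bexE)
    assume t: "steps (hat \<phi> s) (hat \<phi> t1)" "ok t1" "steps (hat \<phi> s) (hat \<phi> t2)" "ok t2"
    then show ?thesis using join[OF t(1,3)] backward by blast
  next
    fix a assume "steps (hat \<phi> s) (hat \<phi> t1)" "ok t1" "a \<in> A" "steps (hat \<phi> s) (Var (\<nu> a))" "steps a t2"
    then show ?thesis by (rule collapse)
  next
    fix a assume "a \<in> A" "steps (hat \<phi> s) (Var (\<nu> a))" "steps a t1" "steps (hat \<phi> s) (hat \<phi> t2)" "ok t2"
    then show ?thesis using collapse[of t2 a t1] by blast
  next
    fix a1 a2
    assume a: "a1 \<in> A" "steps (hat \<phi> s) (Var (\<nu> a1))" "steps a1 t1"
      "a2 \<in> A" "steps (hat \<phi> s) (Var (\<nu> a2))" "steps a2 t2"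
    \<comment> \<open>Joinable variables are equal, so both reductions collapse to the same alien,
      where confluence in rank \<open>Suc k\<close> applies.\<close>
    have "Var (\<nu> a1) = (Var (\<nu> a2) :: ('f, 'v) ctxt)" using join[OF a(2,5)] Var_steps by metis
    then have "a1 = a2" using \<sigma>_\<nu> a(1,4) by (metis ctxt.inject(1))
    then obtain v where "steps t1 v" "steps t2 v"
      using CR A_rank a unfolding confluent_rank_def by blast
    then show ?thesis using steps_short_step rank_le_steps[OF _ A_rank] a by metis
  qed
qed

subsection \<open>Tall steps\<close>

text \<open>The old max-top stays a top of the result. Where the max-top grows, the new aliens have
  rank at most \<open>k\<close> by \<open>rank_leI\<close>, so tall positions can only
  disappear.\<close>

lemma fill_reducts:
  assumes s: "s \<in> rank_le (Suc (Suc k))" and b: "reducts k s b"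
  shows "steps s (fill (max_top s) b)" and "fill (max_top s) b \<in> rank_le (Suc (Suc k))"
    and "max_top s \<sqsubseteq> max_top (fill (max_top s) b)"
    and "tall_poss k (fill (max_top s) b) \<subseteq> tall_poss k s"
proof -
  note sT = rank_le_terms[OF s]
  let ?M = "max_top s" and ?t = "fill (max_top s) b"
  have "steps (fill ?M (subt_at s)) ?t" by (rule fill_steps) (use b in \<open>auto simp: reducts_def\<close>)
  then show st: "steps s ?t" using max_top_le[OF sT] by simp
  from rank_le_steps[OF this s] show tr: "?t \<in> rank_le (Suc (Suc k))" .
  note tT = rank_le_terms[OF tr]
  show le: "?M \<sqsubseteq> max_top ?t" using max_top_greatest[OF tT max_top_LL[OF sT] le_fill] .
  have "b p \<in> rank_le (Suc k)" if "p \<in> hole_poss ?M" for p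
    using that b rank_le_steps alien_rank_le[OF s that] by (auto simp: reducts_def simp del: rank_le.simps)
  then have "aliens ?M ?t \<subseteq> rank_le (Suc k)"
    by (auto simp: aliens_def subt_at_fill_hole simp del: rank_le.simps)
  from rank_leI(2)[OF tT max_top_LL[OF sT] le_fill this]
  have new: "subt_at ?t p \<in> rank_le k" if "p \<in> hole_poss (max_top ?t)" "p \<notin> hole_poss ?M" for p
    using that by simp
  show "tall_poss k ?t \<subseteq> tall_poss k s"
  proof
    fix p assume p: "p \<in> tall_poss k ?t"
    then have pM: "p \<in> hole_poss ?M" using new by (auto simp: tall_poss_def)
    moreover have "subt_at s p \<notin> rank_le k"
      using p b pM by (auto simp: tall_poss_def reducts_def subt_at_fill_hole)
    ultimately show "p \<in> tall_poss k s" by (simp add: tall_poss_def)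
  qed
qed

text \<open>A tall alien stops being tall when it loses rank or is absorbed by the max-top; neither is
  undone by later steps inside it.\<close>

lemma absorbed_step:
  assumes s: "s \<in> rank_le (Suc (Suc k))" and b: "reducts k s b" and q: "q \<in> tall_poss k s"
    and qv: "q \<notin> tall_poss k (fill (max_top s) b)" and step: "rstep R (b q) u"
  shows "short_step k (fill (max_top s) b) (fill (max_top s) (b(q := u)))"
    and "tall_poss k (fill (max_top s) (b(q := u))) \<subseteq> tall_poss k (fill (max_top s) b)"
proof -
  note sT = rank_le_terms[OF s]
  let ?M = "max_top s" and ?v = "fill (max_top s) b" and ?w = "fill (max_top s) (b(q := u))"
  have qM: "q \<in> hole_poss ?M" using q by (simp add: tall_poss_def)
  have q_tall: "subt_at s q \<notin> rank_le k" using q by (simp add: tall_poss_def)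
  have b': "reducts k s (b(q := u))"
    using b step q_tall by (auto simp: reducts_def simp del: rank_le.simps)
  note v = fill_reducts[OF s b] and w = fill_reducts[OF s b']
  note vT = rank_le_terms[OF v(2)] and wT = rank_le_terms[OF w(2)]
  have bq: "b q \<in> rank_le (Suc k)"
    using b rank_le_steps[OF _ alien_rank_le[OF s qM]] qM by (simp add: reducts_def del: rank_le.simps)
  have qNv: "q \<in> poss (max_top ?v)" using le_poss[OF v(3)] qM by (simp add: hole_poss_iff)
  obtain p \<rho> where p: "\<rho> \<in> R" "step_at p \<rho> (b q) u" using step by (auto simp: rstep_def)
  have "q \<in> poss ?v" using poss_fill[OF qM] .
  moreover have "?w = replace_at ?v q u" by (simp add: replace_at_fill[OF qM])
  ultimately have step': "step_at (q @ p) \<rho> ?v ?w"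
    unfolding step_at_append using p(2) by (auto simp: subt_at_fill_hole[OF qM])
  have "q @ p \<noteq> q' @ p'" if q': "q' \<in> tall_poss k ?v" for q' p'
  proof
    assume eq: "q @ p = q' @ p'"
    have "q' \<in> hole_poss ?M" "q' \<noteq> q" using q' v(4) qv by (auto simp: tall_poss_def)
    then have "parallel q q'" using hole_poss_parallel qM by blast
    then have "parallel (q @ p) q'" by (rule parallel_append)
    then show False using eq by (auto simp: parallel_def)
  qed
  then show "short_step k ?v ?w" using v(2) p(1) step' by (auto simp: short_step_def simp del: rank_le.simps)
  show "tall_poss k ?w \<subseteq> tall_poss k ?v"
  proof
    fix q' assume q': "q' \<in> tall_poss k ?w"
    then have q'M: "q' \<in> hole_poss ?M" using w(4) by (auto simp: tall_poss_def)
    have q'w: "q' \<in> hole_poss (max_top ?w)" "subt_at ?w q' \<notin> rank_le k"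
      using q' by (auto simp: tall_poss_def)
    have same: "subt_at ?w q' = subt_at ?v q'" if "q' \<noteq> q"
      using that q'M by (simp add: subt_at_fill_hole)
    have lose: "b q \<notin> rank_le k" if "q' = q"
      using q'w(2) that rank_le_step[OF p] by (auto simp: subt_at_fill_hole[OF qM])
    have tall: "q' \<in> tall_poss k ?v" if "q' \<in> hole_poss (max_top ?v)"
      using that q'w(2) same lose by (cases "q' = q") (auto simp: tall_poss_def subt_at_fill_hole[OF qM])
    have q'Nv: "q' \<in> poss (max_top ?v)" using le_poss[OF v(3)] q'M by (simp add: hole_poss_iff)
    show "q' \<in> tall_poss k ?v"
    proof (cases rule: step_cases[OF vT p(1) step' max_top_le[OF vT]])
      case 1
      obtain L where L: "step_at (q @ p) \<rho> (max_top ?v) L" "L = max_top ?w \<or> L = \<box> \<and> q @ p = []"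
        using step_in_top[OF vT p(1) step' 1] by metis
      \<comment> \<open>A step below \<open>q\<close> is not at the root, so it cannot collapse the
        whole term.\<close>
      have "q \<noteq> []" using qM max_top_not_Hole[OF sT] by auto
      then have "L = max_top ?w" using L(2) by simp
      then obtain L' where L': "step_at p \<rho> (subt_at (max_top ?v) q) L'"
        "max_top ?w = replace_at (max_top ?v) q L'"
        using L(1) unfolding step_at_append by blast
      show ?thesis
      proof (cases "q' = q")
        case False
        then have "subt_at (max_top ?w) q' = subt_at (max_top ?v) q'"
          using L'(2) replace_at_parallel(2)[OF qNv hole_poss_parallel[OF qM q'M]] q'Nv by simp
        then show ?thesis using tall q'w(1) q'Nv by (simp add: hole_poss_iff)
      next
        case True
        \<comment> \<open>The hole at \<open>q\<close> could return only through a collapse at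
          \<open>q\<close> itself. Its result is an alien inside the absorbed part, of rank at most
          \<open>k\<close>, so \<open>q\<close> is not tall.\<close>
        then have "L' = \<box>" using q'w(1) qNv L'(2) by (simp add: hole_poss_iff)
        then have root: "p = []" using L'(1) unfolding step_at_def by (metis replace_at_eq_Hole)
        have "u \<in> rank_le k"
        proof -
          have sub: "q \<in> fun_poss (max_top ?v)" using 1 root by simp
          then have "subt_at (max_top ?v) q \<noteq> \<box>" by (auto simp: fun_poss_iff)
          then have "aliens (subt_at (max_top ?v) q) (b q) \<subseteq> rank_le k"
            using aliens_subt_at_max_top[OF vT qNv] bq by (simp add: subt_at_fill_hole[OF qM] del: rank_le.simps)
          moreover have "u \<in> aliens (subt_at (max_top ?v) q) (b q)"
          proof -
            obtain \<tau> where \<tau>: "subt_at (max_top ?v) q = fst \<rho> \<cdot> \<tau>" "snd \<rho> \<cdot> \<tau> = \<box>"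
              using L'(1) \<open>L' = \<box>\<close> root by (auto simp: step_at_def)
            obtain \<sigma> where \<sigma>: "b q = fst \<rho> \<cdot> \<sigma>" "u = snd \<rho> \<cdot> \<sigma>"
              using p(2) root by (auto simp: step_at_def)
            have "u \<in> aliens (snd \<rho> \<cdot> \<tau>) (snd \<rho> \<cdot> \<sigma>)" using \<tau> \<sigma> by simp
            then show ?thesis unfolding \<tau>(1) \<sigma>(1) using aliens_rule[OF p(1)] by blast
          qed
          ultimately show ?thesis by blast
        qed
        then show ?thesis using q'w(2) True by (simp add: subt_at_fill_hole[OF qM])
      qed
    next
      case 2
      then have "max_top ?v \<sqsubseteq> max_top ?w" using max_top_greatest[OF wT max_top_LL[OF vT]] by blast
      then have "subt_at (max_top ?v) q' \<sqsubseteq> \<box>"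
        using le_subt_at[OF _ q'Nv] q'w(1) by (metis hole_poss_iff)
      then show ?thesis using tall q'Nv by (simp add: hole_poss_iff)
    qed
  qed
qed

text \<open>The inclusion of tall positions keeps \<open>q\<close> from becoming tall, so single
  steps can be iterated.\<close>

lemma absorbed_steps:
  assumes s: "s \<in> rank_le (Suc (Suc k))" and b: "reducts k s b" and q: "q \<in> tall_poss k s"
    and qv: "q \<notin> tall_poss k (fill (max_top s) b)" and u: "steps (b q) u"
  shows "reducts k s (b(q := u)) \<and>
    (short_step k)\<^sup>*\<^sup>* (fill (max_top s) b) (fill (max_top s) (b(q := u))) \<and>
    tall_poss k (fill (max_top s) (b(q := u))) \<subseteq> tall_poss k (fill (max_top s) b)"
  using u
proof (induction rule: rtranclp_induct)
  case base
  then show ?case using b by simp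
next
  case (step u u')
  let ?b = "b(q := u)"
  have b': "reducts k s ?b" using step.IH by blast
  have "q \<notin> tall_poss k (fill (max_top s) ?b)" using step.IH qv by blast
  note * = absorbed_step[OF s b' q this, of u', simplified, OF step.hyps(2)]
  have "subt_at s q \<notin> rank_le k" using q by (simp add: tall_poss_def)
  then have "reducts k s (b(q := u'))"
    using b' step.hyps(2) unfolding reducts_def
    by (metis fun_upd_apply rtranclp.rtrancl_into_rtrancl)
  then show ?case using * step.IH by (meson order_trans rtranclp.rtrancl_into_rtrancl)
qed

lemma absorbed_all_steps:
  assumes s: "s \<in> rank_le (Suc (Suc k))" and b: "reducts k s b"
    and "finite Q" "Q \<subseteq> tall_poss k s" "Q \<inter> tall_poss k (fill (max_top s) b) = {}"
    and d: "\<And>q. q \<in> Q \<Longrightarrow> steps (b q) (d q)"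
  shows "(short_step k)\<^sup>*\<^sup>* (fill (max_top s) b) (fill (max_top s) (\<lambda>q. if q \<in> Q then d q else b q))"
proof -
  let ?b = "\<lambda>Q q. if q \<in> Q then d q else b q"
  have "reducts k s (?b Q) \<and> (short_step k)\<^sup>*\<^sup>* (fill (max_top s) b) (fill (max_top s) (?b Q)) \<and>
      tall_poss k (fill (max_top s) (?b Q)) \<subseteq> tall_poss k (fill (max_top s) b)"
    using assms(3-6)
  proof (induction Q)
    case (insert q Q)
    then have IH: "reducts k s (?b Q)" "(short_step k)\<^sup>*\<^sup>* (fill (max_top s) b) (fill (max_top s) (?b Q))"
      "tall_poss k (fill (max_top s) (?b Q)) \<subseteq> tall_poss k (fill (max_top s) b)" by simp_all
    have eq: "(?b Q)(q := d q) = ?b (insert q Q)" by auto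
    have "reducts k s ((?b Q)(q := d q)) \<and>
      (short_step k)\<^sup>*\<^sup>* (fill (max_top s) (?b Q)) (fill (max_top s) ((?b Q)(q := d q))) \<and>
      tall_poss k (fill (max_top s) ((?b Q)(q := d q))) \<subseteq> tall_poss k (fill (max_top s) (?b Q))"
      using insert IH(3) by (intro absorbed_steps[OF s IH(1)]) auto
    then show ?case unfolding eq using IH by (meson order_trans rtranclp_trans)
  qed (use b in simp)
  then show ?thesis by blast
qed

text \<open>Positions still tall after \<open>b\<close> are finished by one tall step, those that
  ceased to be tall by short steps. As tall positions only disappear, the values of \<open>d\<close>
  bound the label.\<close>

lemma tall_step_to:
  assumes s: "s \<in> rank_le (Suc (Suc k))" and b: "reducts k s b" and d: "reducts k s d"
    and bd: "\<And>p. p \<in> tall_poss k s \<Longrightarrow> steps (b p) (d p)"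
  shows "\<exists>m t. m \<le> card (d ` tall_poss k s) \<and> tall_step k m (fill (max_top s) b) t \<and>
    (short_step k)\<^sup>*\<^sup>* t (fill (max_top s) d)"
proof -
  let ?M = "max_top s" and ?t = "fill (max_top s) b"
  note t = fill_reducts[OF s b]
  note tT = rank_le_terms[OF t(2)]
  \<comment> \<open>The tall step from \<open>?t\<close> has to be described over its own max-top,
    by \<open>c\<close>; \<open>e\<close> describes the same result over \<open>?M\<close>.\<close>
  define c where "c p = (if p \<in> tall_poss k ?t then d p else subt_at ?t p)" for p
  define e where "e p = (if p \<in> tall_poss k ?t then d p else b p)" for p
  have tall_M: "p \<in> hole_poss ?M" if "p \<in> tall_poss k ?t" for p
    using that t(4) by (auto simp: tall_poss_def)
  have "steps (subt_at ?t p) (c p)" for p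
    using bd[of p] t(4) tall_M[of p] by (cases "p \<in> tall_poss k ?t") (auto simp: c_def subt_at_fill_hole)
  moreover have "c p = subt_at ?t p" if "subt_at ?t p \<in> rank_le k" for p
    using that by (simp add: c_def tall_poss_def)
  ultimately have c: "reducts k ?t c" by (simp add: reducts_def)
  have e: "reducts k s e" using b d by (auto simp: reducts_def e_def)
  have ce: "fill (max_top ?t) c = fill ?M e"
    unfolding fill_le[OF t(3)]
  proof (rule fill_cong)
    fix p assume p: "p \<in> hole_poss ?M"
    then have pN: "p \<in> poss (max_top ?t)" using le_poss[OF t(3)] by (simp add: hole_poss_iff)
    show "fill (subt_at (max_top ?t) p) (\<lambda>q. c (p @ q)) = e p"
    proof (cases "p \<in> tall_poss k ?t")
      case True
      then show ?thesis by (simp add: c_def e_def tall_poss_def hole_poss_iff)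
    next
      case False
      have "c (p @ q) = subt_at (subt_at ?t p) q" if "q \<in> hole_poss (subt_at (max_top ?t) p)" for q
      proof -
        have "p @ q \<notin> tall_poss k ?t"
          using False tall_M[of "p @ q"] hole_poss_antichain[OF p] by fastforce
        then show ?thesis using le_poss[OF max_top_le[OF tT] pN] by (simp add: c_def subt_at_append)
      qed
      then have "fill (subt_at (max_top ?t) p) (\<lambda>q. c (p @ q)) =
          fill (subt_at (max_top ?t) p) (subt_at (subt_at ?t p))" by (rule fill_cong)
      also have "\<dots> = subt_at ?t p" using le_subt_at[OF max_top_le[OF tT] pN] by simp
      finally show ?thesis using False p by (simp add: e_def subt_at_fill_hole)
    qed
  qed
  have "c ` tall_poss k ?t \<subseteq> d ` tall_poss k s" using t(4) by (auto simp: c_def)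
  then have "card (c ` tall_poss k ?t) \<le> card (d ` tall_poss k s)"
    by (intro card_mono) (simp_all add: finite_tall_poss)
  moreover have "tall_step k (card (c ` tall_poss k ?t)) ?t (fill ?M e)"
    using t(2) c ce unfolding tall_step_def by metis
  moreover have "(short_step k)\<^sup>*\<^sup>* (fill ?M e) (fill ?M d)"
  proof -
    let ?Q = "tall_poss k s - tall_poss k ?t"
    have "tall_poss k (fill ?M e) \<subseteq> tall_poss k ?t"
      using fill_reducts(4)[OF t(2) c] ce by simp
    then have "(short_step k)\<^sup>*\<^sup>* (fill ?M e) (fill ?M (\<lambda>q. if q \<in> ?Q then d q else e q))"
      using finite_tall_poss bd by (intro absorbed_all_steps[OF s e]) (auto simp: e_def)
    moreover have "fill ?M (\<lambda>q. if q \<in> ?Q then d q else e q) = fill ?M d"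
      using b d by (intro fill_cong) (auto simp: e_def tall_poss_def reducts_def)
    ultimately show ?thesis by simp
  qed
  ultimately show ?thesis by blast
qed

section \<open>Common reducts and labelled peaks\<close>

text \<open>By confluence, joinability is an equivalence on \<open>rank_le n\<close>, and each of
  the finitely many classes meeting \<open>X\<close> gets one common reduct.\<close>

lemma common_reducts:
  assumes CR: "confluent_rank n" and "finite X" "X \<subseteq> rank_le n"
  obtains D where "\<forall>x \<in> X. steps x (D x)"
    "\<forall>x \<in> X. \<forall>y \<in> X. \<forall>z. steps x z \<longrightarrow> steps y z \<longrightarrow> D x = D y"
proof -
  define J where "J a b \<longleftrightarrow> (\<exists>z. steps a z \<and> steps b z)" for a b
  have J_sym: "J b a" if "J a b" for a b using that by (auto simp: J_def)
  have J_trans: "J a c" if ab: "J a b" and bc: "J b c" and r: "b \<in> rank_le n" for a b c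
  proof -
    obtain y z where yz: "steps a y" "steps b y" "steps b z" "steps c z" using ab bc by (auto simp: J_def)
    then obtain w where "steps y w" "steps z w" using CR r unfolding confluent_rank_def by blast
    then show ?thesis using yz unfolding J_def by (meson rtranclp_trans)
  qed
  have "\<exists>D. (\<forall>x \<in> X. steps x (D x)) \<and> (\<forall>x \<in> X. \<forall>y \<in> X. J x y \<longrightarrow> D x = D y)"
    using assms(2,3)
  proof (induction X)
    case (insert x X)
    then have "X \<subseteq> rank_le n" by simp
    from insert.IH[OF this] obtain D where D0: "(\<forall>x \<in> X. steps x (D x)) \<and> (\<forall>x \<in> X. \<forall>y \<in> X. J x y \<longrightarrow> D x = D y)"
      by (rule exE)
    have D: "\<And>y. y \<in> X \<Longrightarrow> steps y (D y)" "\<And>y z. y \<in> X \<Longrightarrow> z \<in> X \<Longrightarrow> J y z \<Longrightarrow> D y = D z"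
      using D0 by blast+
    show ?case
    proof (cases "\<exists>y \<in> X. J x y")
      case False
      show ?thesis
      proof (intro exI[of _ "D(x := x)"] conjI ballI impI)
        show "steps a ((D(x := x)) a)" if "a \<in> insert x X" for a
          using that D(1) by (cases "a = x") auto
        show "(D(x := x)) a = (D(x := x)) b" if "a \<in> insert x X" "b \<in> insert x X" "J a b" for a b
          using that False J_sym[of a b] D(2)[of a b] by (cases "a = x"; cases "b = x") auto
      qed
    next
      case True
      then obtain y where y: "y \<in> X" "J x y" by blast
      then have "J x (D y)" using J_trans[of x y "D y"] D(1)[OF y(1)] insert.prems by (auto simp: J_def)
      then obtain w where w: "steps x w" "steps (D y) w" by (auto simp: J_def)
      \<comment> \<open>When \<open>x\<close> enters the class of \<open>y\<close>, the whole class
        moves on to the common reduct \<open>w\<close> of \<open>x\<close> and the former choice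
        \<open>D y\<close>.\<close>
      define D' where "D' a = (if a = x \<or> J a y then w else D a)" for a
      have "steps a (D' a)" if a: "a \<in> insert x X" for a
      proof (cases "a = x \<or> \<not> J a y")
        case True
        then show ?thesis using a w(1) D(1) by (auto simp: D'_def)
      next
        case False
        then have "steps a (D y)" using a y(1) D(1)[of a] D(2)[of a y] by auto
        then show ?thesis using False w(2) by (simp add: D'_def)
      qed
      moreover have "D' a = D' b" if ab: "a \<in> insert x X" "b \<in> insert x X" "J a b" for a b
      proof -
        have *: "a = x \<or> J a y \<longleftrightarrow> b = x \<or> J b y"
          using J_trans[of a b y] J_trans[of b a y] J_sym[OF ab(3)] ab y insert.prems
          by blast
        then show ?thesis using ab D(2) by (auto simp: D'_def)
      qed
      ultimately show ?thesis by blast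
    qed
  qed simp
  then obtain D where D: "(\<forall>x \<in> X. steps x (D x)) \<and> (\<forall>x \<in> X. \<forall>y \<in> X. J x y \<longrightarrow> D x = D y)"
    by (rule exE)
  show ?thesis by (rule that[of D]) (use D in \<open>auto simp: J_def\<close>)
qed

text \<open>\<open>D\<close> acts on results rather than positions, so equal results stay equal and
  their number cannot grow. Results of equal aliens are joinable, hence merged. Taking
  \<open>c = b\<close> yields balancing.\<close>

lemma joint_reducts:
  assumes s: "s \<in> rank_le (Suc (Suc k))" and CR: "confluent_rank (Suc k)"
    and b: "reducts k s b" and c: "reducts k s c"
  obtains D where
    "\<forall>p \<in> tall_poss k s. steps (b p) (D (b p)) \<and> steps (c p) (D (c p)) \<and> D (c p) = D (b p)"
    "\<forall>p \<in> tall_poss k s. \<forall>q \<in> tall_poss k s. subt_at s p = subt_at s q \<longrightarrow> D (b p) = D (b q)"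
    "reducts k s (\<lambda>p. if p \<in> tall_poss k s then D (b p) else subt_at s p)"
proof -
  let ?P = "tall_poss k s"
  have bs: "steps (subt_at s p) (b p)" "steps (subt_at s p) (c p)" if "p \<in> ?P" for p
    using that b c by (auto simp: tall_poss_def reducts_def)
  have sr: "subt_at s p \<in> rank_le (Suc k)" if "p \<in> ?P" for p
    using that alien_rank_le[OF s] unfolding tall_poss_def by blast
  let ?X = "b ` ?P \<union> c ` ?P"
  have "?X \<subseteq> rank_le (Suc k)" using bs sr rank_le_steps by blast
  moreover have "finite ?X" by (simp add: finite_tall_poss)
  ultimately obtain D where D0: "\<forall>x \<in> ?X. steps x (D x)"
    "\<forall>x \<in> ?X. \<forall>y \<in> ?X. \<forall>z. steps x z \<longrightarrow> steps y z \<longrightarrow> D x = D y"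
    using common_reducts[OF CR, of ?X] by metis
  then have D: "\<And>x. x \<in> ?X \<Longrightarrow> steps x (D x)"
    "\<And>x y. x \<in> ?X \<Longrightarrow> y \<in> ?X \<Longrightarrow> \<exists>z. steps x z \<and> steps y z \<Longrightarrow> D x = D y"
    by blast+
  have join: "\<exists>z. steps x z \<and> steps y z" if "p \<in> ?P" "steps (subt_at s p) x" "steps (subt_at s p) y" for p x y
    using CR sr that unfolding confluent_rank_def by blast
  show ?thesis
  proof (rule that[of D])
    have "steps (b p) (D (b p)) \<and> steps (c p) (D (c p)) \<and> D (c p) = D (b p)" if p: "p \<in> ?P" for p
      using p D(1)[of "b p"] D(1)[of "c p"] D(2)[of "c p" "b p"] join[OF p bs(2,1)[OF p]] by simp
    then show "\<forall>p \<in> ?P. steps (b p) (D (b p)) \<and> steps (c p) (D (c p)) \<and> D (c p) = D (b p)" by blast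
    have "D (b p) = D (b q)" if "p \<in> ?P" "q \<in> ?P" "subt_at s p = subt_at s q" for p q
      using that D(2)[of "b p" "b q"] join[OF that(1), of "b p" "b q"] bs(1)[of p] bs(1)[of q] by simp
    then show "\<forall>p \<in> ?P. \<forall>q \<in> ?P. subt_at s p = subt_at s q \<longrightarrow> D (b p) = D (b q)" by blast
    have "steps (subt_at s p) (D (b p))" if "p \<in> ?P" for p
      using rtranclp_trans[OF bs(1)[OF that] D(1)] that by blast
    then show "reducts k s (\<lambda>p. if p \<in> ?P then D (b p) else subt_at s p)"
      by (auto simp: reducts_def tall_poss_def)
  qed
qed

lemma tall_tall_peak:
  assumes CR: "confluent_rank (Suc k)" and "tall_step k m s t" "tall_step k n s u"
  shows "\<exists>i j t' u' v. i \<le> m \<and> i \<le> n \<and> j \<le> m \<and> j \<le> n \<and>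
    tall_step k i t t' \<and> (short_step k)\<^sup>*\<^sup>* t' v \<and> tall_step k j u u' \<and> (short_step k)\<^sup>*\<^sup>* u' v"
proof -
  let ?P = "tall_poss k s"
  obtain b c where s: "s \<in> rank_le (Suc (Suc k))" and b: "reducts k s b" and c: "reducts k s c"
    and t: "t = fill (max_top s) b" "m = card (b ` ?P)" and u: "u = fill (max_top s) c" "n = card (c ` ?P)"
    using assms unfolding tall_step_def by blast
  obtain D where D: "\<forall>p \<in> ?P. steps (b p) (D (b p)) \<and> steps (c p) (D (c p)) \<and> D (c p) = D (b p)"
    "\<forall>p \<in> ?P. \<forall>q \<in> ?P. subt_at s p = subt_at s q \<longrightarrow> D (b p) = D (b q)"
    "reducts k s (\<lambda>p. if p \<in> ?P then D (b p) else subt_at s p)"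
    by (rule joint_reducts[OF s CR b c])
  let ?d = "\<lambda>p. if p \<in> ?P then D (b p) else subt_at s p"
  \<comment> \<open>The target values are the image under \<open>D\<close> of the results of either
    step, which bounds both labels.\<close>
  have "?d ` ?P = D ` b ` ?P" "?d ` ?P = D ` c ` ?P" using D(1) by (auto simp: image_iff)
  then have le: "card (?d ` ?P) \<le> m" "card (?d ` ?P) \<le> n"
    unfolding t u by (metis card_image_le finite_imageI finite_tall_poss)+
  obtain i t' where "i \<le> card (?d ` ?P)" "tall_step k i t t'" "(short_step k)\<^sup>*\<^sup>* t' (fill (max_top s) ?d)"
    using tall_step_to[OF s b D(3)] D(1) t(1) by auto
  moreover have "steps (c p) (D (b p))" if "p \<in> ?P" for p using D(1) that by metis
  then obtain j u' where "j \<le> card (?d ` ?P)" "tall_step k j u u'" "(short_step k)\<^sup>*\<^sup>* u' (fill (max_top s) ?d)"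
    using tall_step_to[OF s c D(3)] u(1) by auto
  ultimately show ?thesis using le by (meson le_trans)
qed

text \<open>The relation required as \<open>A\<close> in \<open>labelled_confluence\<close>.\<close>

definition mixed_steps :: "nat \<Rightarrow> nat \<Rightarrow> ('f, 'v) ctxt \<Rightarrow> ('f, 'v) ctxt \<Rightarrow> bool" where
  "mixed_steps k n = (\<lambda>x y. short_step k x y \<or> (\<exists>m < n. tall_step k m x y))\<^sup>*\<^sup>*"

text \<open>Labels below \<open>n\<close> suffice because balancing, if it is needed at all, strictly decreases the
  number of distinct results.\<close>

lemma balance:
  assumes s: "s \<in> rank_le (Suc (Suc k))" and CR: "confluent_rank (Suc k)" and b: "reducts k s b"
    and n: "n = card (b ` tall_poss k s)"
  obtains c where "reducts k s c" "card (c ` tall_poss k s) \<le> n"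
    "mixed_steps k n (fill (max_top s) b) (fill (max_top s) c)"
    "\<forall>p \<in> tall_poss k s. \<forall>q \<in> tall_poss k s. subt_at s p = subt_at s q \<longrightarrow> c p = c q"
proof -
  let ?P = "tall_poss k s"
  obtain D where D: "\<forall>p \<in> ?P. steps (b p) (D (b p)) \<and> steps (b p) (D (b p)) \<and> D (b p) = D (b p)"
    "\<forall>p \<in> ?P. \<forall>q \<in> ?P. subt_at s p = subt_at s q \<longrightarrow> D (b p) = D (b q)"
    "reducts k s (\<lambda>p. if p \<in> ?P then D (b p) else subt_at s p)"
    by (rule joint_reducts[OF s CR b b])
  let ?d = "\<lambda>p. if p \<in> ?P then D (b p) else subt_at s p"
  have d: "?d ` ?P = D ` b ` ?P" by (auto simp: image_iff)
  show ?thesis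
  \<comment> \<open>An injective \<open>D\<close> merges nothing, so \<open>b\<close> is already
    balanced; otherwise the number of values drops.\<close>
  proof (cases "inj_on D (b ` ?P)")
    case True
    show ?thesis
    proof (rule that[of b])
      have "b p = b q" if "p \<in> ?P" "q \<in> ?P" "subt_at s p = subt_at s q" for p q
      proof -
        have "D (b p) = D (b q)" using D(2) that by blast
        then show ?thesis using that by (intro inj_onD[OF True, of "b p" "b q"]) auto
      qed
      then show "\<forall>p \<in> ?P. \<forall>q \<in> ?P. subt_at s p = subt_at s q \<longrightarrow> b p = b q" by blast
    qed (use b n in \<open>simp_all add: mixed_steps_def\<close>)
  next
    case False
    then have less: "card (?d ` ?P) < n"
      unfolding d n by (metis card_image_le eq_card_imp_inj_on finite_imageI finite_tall_poss le_neq_implies_less)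
    obtain m t where m: "m \<le> card (?d ` ?P)" "tall_step k m (fill (max_top s) b) t"
      "(short_step k)\<^sup>*\<^sup>* t (fill (max_top s) ?d)"
      using tall_step_to[OF s b D(3)] D(1) by auto
    have "mixed_steps k n (fill (max_top s) b) t"
      unfolding mixed_steps_def using m less by (intro r_into_rtranclp) auto
    moreover have "mixed_steps k n t (fill (max_top s) ?d)"
      unfolding mixed_steps_def using m(3) by (rule rtranclp_mono[THEN predicate2D, rotated]) auto
    ultimately have mixed: "mixed_steps k n (fill (max_top s) b) (fill (max_top s) ?d)"
      unfolding mixed_steps_def by simp
    have "?d p = ?d q" if "p \<in> ?P" "q \<in> ?P" "subt_at s p = subt_at s q" for p q
      using that D(2)[rule_format, of p q] by simp
    then have "\<forall>p \<in> ?P. \<forall>q \<in> ?P. subt_at s p = subt_at s q \<longrightarrow> ?d p = ?d q" by blast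
    then show ?thesis using that[OF D(3) less_imp_le[OF less] mixed] by blast
  qed
qed

text \<open>After balancing, results depend only on the aliens, so the tall step becomes
  \<open>hat \<beta>\<close>, and the short step carries over. On the other side
  \<open>hat \<beta> u\<close> arises by a tall step from \<open>u\<close>; if the short step
  collapses, \<open>u\<close> is a tall alien of \<open>s\<close> and reduces to
  \<open>\<beta> u\<close> by short steps.\<close>

lemma short_tall_peak:
  assumes CR: "confluent_rank (Suc k)" and su: "short_step k s u" and st: "tall_step k n s t"
  shows "\<exists>v. mixed_steps k n t v \<and> ((short_step k)\<^sup>*\<^sup>* u v \<or> (\<exists>m \<le> n. tall_step k m u v))"
proof -
  let ?P = "tall_poss k s" and ?M = "max_top s"
  obtain b where s: "s \<in> rank_le (Suc (Suc k))" and b: "reducts k s b"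
    and t: "t = fill ?M b" "n = card (b ` ?P)"
    using st unfolding tall_step_def by blast
  obtain c where c: "reducts k s c" "card (c ` ?P) \<le> n" "mixed_steps k n (fill ?M b) (fill ?M c)"
    "\<forall>p \<in> ?P. \<forall>q \<in> ?P. subt_at s p = subt_at s q \<longrightarrow> c p = c q"
    by (rule balance[OF s CR b t(2)])
  \<comment> \<open>By balance, the value does not depend on the chosen \<open>p\<close>.\<close>
  define \<beta> where "\<beta> a = (if a \<in> tall_aliens k s then c (SOME p. p \<in> ?P \<and> subt_at s p = a) else a)" for a
  have \<beta>: "\<beta> (subt_at s p) = c p" if p: "p \<in> ?P" for p
  proof -
    have "\<exists>q. q \<in> ?P \<and> subt_at s q = subt_at s p" using p by blast
    from someI_ex[OF this] have "c (SOME q. q \<in> ?P \<and> subt_at s q = subt_at s p) = c p"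
      using c(4) p by blast
    then show ?thesis using p by (simp add: \<beta>_def tall_aliens_eq)
  qed
  have \<beta>_id: "\<beta> a = a" if "a \<in> rank_le k" for a using that by (auto simp: \<beta>_def tall_aliens_def)
  have hat: "fill ?M c = hat \<beta> s"
    unfolding map_aliens_def
  proof (rule fill_cong)
    show "c p = \<beta> (subt_at s p)" if "p \<in> hole_poss ?M" for p
      using that \<beta>[of p] \<beta>_id c(1) by (cases "p \<in> ?P") (auto simp: tall_poss_def reducts_def)
  qed
  obtain p \<rho> where p: "\<rho> \<in> R" "step_at p \<rho> s u" "\<And>q p'. q \<in> ?P \<Longrightarrow> p \<noteq> q @ p'"
    using su unfolding short_step_def by blast
  obtain v where v: "step_at p \<rho> (hat \<beta> s) v"
    "v = hat \<beta> u \<and> tall_aliens k u \<subseteq> tall_aliens k s \<or> v = \<beta> u \<and> u \<in> tall_aliens k s"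
    using short_step_hat[OF s p \<beta>_id] by blast
  note fc = fill_reducts[OF s c(1)]
  \<comment> \<open>Still short, because no new tall positions have arisen.\<close>
  have "short_step k (fill ?M c) v"
    unfolding short_step_def using fc(2,4) p(1,3) v(1) hat by (metis subsetD)
  then have "mixed_steps k n t v"
    using c(3) t(1) unfolding mixed_steps_def by (auto intro: rtranclp.rtrancl_into_rtrancl)
  moreover have u: "u \<in> rank_le (Suc (Suc k))" using rank_le_step[OF p(1,2) s] .
  have \<beta>_steps: "steps a (\<beta> a)" if "a \<in> tall_aliens k s" for a
    using that c(1) \<beta> by (auto simp: tall_aliens_eq tall_poss_def reducts_def)
  from v(2) have "(short_step k)\<^sup>*\<^sup>* u v \<or> (\<exists>m \<le> n. tall_step k m u v)"
  proof (elim disjE conjE)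
    assume v: "v = hat \<beta> u" and sub: "tall_aliens k u \<subseteq> tall_aliens k s"
    let ?b = "\<lambda>q. \<beta> (subt_at u q)"
    have "reducts k u ?b"
      unfolding reducts_def
    proof (intro ballI conjI impI)
      fix q assume q: "q \<in> hole_poss (max_top u)"
      show "\<beta> (subt_at u q) = subt_at u q" if "subt_at u q \<in> rank_le k" using \<beta>_id that .
      show "steps (subt_at u q) (\<beta> (subt_at u q))"
        using q sub \<beta>_steps \<beta>_id by (cases "subt_at u q \<in> rank_le k") (auto simp: tall_aliens_def aliens_def)
    qed
    moreover have "card (?b ` tall_poss k u) \<le> n"
    proof -
      have "?b ` tall_poss k u = \<beta> ` tall_aliens k u" by (simp add: tall_aliens_eq image_image)
      also have "\<dots> \<subseteq> c ` ?P" using sub \<beta> unfolding tall_aliens_eq by auto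
      finally have "card (?b ` tall_poss k u) \<le> card (c ` ?P)"
        by (intro card_mono) (simp_all add: finite_tall_poss)
      then show ?thesis using c(2) by simp
    qed
    ultimately show ?thesis using u v unfolding tall_step_def map_aliens_def by blast
  next
    assume v: "v = \<beta> u" and us: "u \<in> tall_aliens k s"
    have "u \<in> rank_le (Suc k)"
      using us aliens_rank_le[OF s] by (auto simp: tall_aliens_def simp del: rank_le.simps)
    then show ?thesis using v steps_short_step[OF \<beta>_steps[OF us]] by blast
  qed
  ultimately show ?thesis by blast
qed

text \<open>One step inside a tall alien is a tall step with empty reductions at all other
  positions.\<close>

lemma rstep_short_or_tall:
  assumes s: "s \<in> rank_le (Suc (Suc k))" and step: "rstep R s t"
  shows "short_step k s t \<or> (\<exists>n. tall_step k n s t)"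
proof -
  obtain p \<rho> where p: "\<rho> \<in> R" "step_at p \<rho> s t" using step by (auto simp: rstep_def)
  show ?thesis
  proof (cases "\<exists>q \<in> tall_poss k s. \<exists>p'. p = q @ p'")
    case False
    then show ?thesis using s p by (auto simp: short_step_def simp del: rank_le.simps)
  next
    case True
    then obtain q p' where q: "q \<in> tall_poss k s" "p = q @ p'" by blast
    then have qM: "q \<in> hole_poss (max_top s)" by (simp add: tall_poss_def)
    obtain u where u: "step_at p' \<rho> (subt_at s q) u" "t = replace_at s q u"
      using p(2) unfolding q(2) step_at_append by blast
    have "rstep R (subt_at s q) u" using u(1) p(1) by (auto simp: rstep_def)
    then have "reducts k s ((subt_at s)(q := u))"
      using q(1) by (auto simp: reducts_def tall_poss_def)
    moreover have "t = fill (max_top s) ((subt_at s)(q := u))"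
      using replace_at_fill[OF qM, of "subt_at s" u] max_top_le[OF rank_le_terms[OF s]] u(2) by simp
    ultimately show ?thesis using s unfolding tall_step_def by blast
  qed
qed

text \<open>Two finite reductions use finitely many labels, so a common strict bound
  \<open>n\<close> exists.\<close>

lemma confluent_rank_Suc:
  assumes inf: "infinite (UNIV :: 'v set)" and CR: "confluent_rank (Suc k)"
  shows "confluent_rank (Suc (Suc k))"
  unfolding confluent_rank_def
proof (intro ballI allI impI)
  fix s t u assume s: "s \<in> rank_le (Suc (Suc k))" and tu: "steps s t \<and> steps s u"
  have mono: "mixed_steps k n x y" if "mixed_steps k m x y" "m \<le> n" for m n x y
    using that(1) unfolding mixed_steps_def
    by (rule rtranclp_mono[THEN predicate2D, rotated]) (use that(2) in auto)
  have ex: "\<exists>n. mixed_steps k n s t" if "steps s t" for t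
    using that
  proof (induction rule: rtranclp_induct)
    case base
    then show ?case by (auto simp: mixed_steps_def)
  next
    case (step t u)
    then obtain n where n: "mixed_steps k n s t" by blast
    have "short_step k t u \<or> (\<exists>m. tall_step k m t u)"
      using rstep_short_or_tall[OF rank_le_steps[OF step.hyps(1) s] step.hyps(2)] .
    then obtain m where "mixed_steps k m t u"
      unfolding mixed_steps_def by (blast intro: r_into_rtranclp lessI)
    then have "mixed_steps k (max m n) s t" "mixed_steps k (max m n) t u" using mono n by simp_all
    then show ?case unfolding mixed_steps_def by (meson rtranclp_trans)
  qed
  obtain n where n: "mixed_steps k n s t" "mixed_steps k n s u"
    using ex mono tu by (meson max.cobounded1 max.cobounded2)
  have "\<exists>v. mixed_steps k n t v \<and> mixed_steps k n u v"
    using n by (intro labelled_confluence[of "mixed_steps k" "short_step k" "tall_step k"]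
        short_step_confluent[OF inf CR] tall_tall_peak[OF CR] short_tall_peak[OF CR])
      (simp_all add: mixed_steps_def)
  moreover have "steps x y" if "mixed_steps k n x y" for x y
  proof -
    have "steps x y" if "short_step k x y \<or> (\<exists>m < n. tall_step k m x y)" for x y
      using that short_step_rstep fill_reducts(1) unfolding tall_step_def by blast
    then have "(\<lambda>x y. short_step k x y \<or> (\<exists>m < n. tall_step k m x y)) \<le> steps" by blast
    from rtranclp_mono[OF this] show ?thesis using that by (auto simp: mixed_steps_def)
  qed
  ultimately show "\<exists>v. steps t v \<and> steps u v" by blast
qed

section \<open>From bounded rank to all terms\<close>

lemma steps_restrict:
  assumes "\<forall>s t. s \<in> S \<and> rstep R s t \<longrightarrow> t \<in> S" "steps s t" "s \<in> S"
  shows "(rstep_on S R)\<^sup>*\<^sup>* s t \<and> t \<in> S"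
  using assms(2)
proof (induction rule: rtranclp_induct)
  case (step t u)
  then have "rstep_on S R t u" "u \<in> S" using assms(1) by (auto simp: rstep_on_def)
  then show ?case using step.IH by (meson rtranclp.rtrancl_into_rtrancl)
qed (use assms(3) in simp)

lemma rstep_on_steps: "(rstep_on S R)\<^sup>*\<^sup>* s t \<Longrightarrow> steps s t"
  by (rule rtranclp_mono[THEN predicate2D]) (auto simp: rstep_on_def)

lemma confluent_rank_1:
  assumes "confluent_on (\<LL> \<inter> terms F) R"
  shows "confluent_rank (Suc 0)"
  unfolding confluent_rank_def rank_le_1
proof (intro ballI allI impI)
  fix s t u assume s: "s \<in> \<LL> \<inter> terms F" and tu: "steps s t \<and> steps s u"
  have closed: "\<forall>s t. s \<in> \<LL> \<inter> terms F \<and> rstep R s t \<longrightarrow> t \<in> \<LL> \<inter> terms F"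
    and CR: "confluentp (rstep_on (\<LL> \<inter> terms F) R)"
    using assms unfolding confluent_on_def by blast+
  show "\<exists>v. steps t v \<and> steps u v"
    using confluentpD[OF CR] steps_restrict[OF closed _ s] tu rstep_on_steps by meson
qed

lemma confluent_trs:
  assumes "infinite (UNIV :: 'v set)" "confluent_on (\<LL> \<inter> terms F) R"
  shows "confluent_trs F R"
  unfolding confluent_trs_def
proof (rule confluentpI)
  have CR: "confluent_rank n" for n
  proof (cases n)
    case 0
    then show ?thesis by (simp add: confluent_rank_def)
  next
    case (Suc m)
    have "confluent_rank (Suc m)"
      by (induction m) (use confluent_rank_1[OF assms(2)] confluent_rank_Suc[OF assms(1)] in auto)
    then show ?thesis using Suc by simp
  qed
  have closed: "\<forall>s t. s \<in> terms F \<and> rstep R s t \<longrightarrow> t \<in> terms F"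
    using step_at_terms by (auto simp: rstep_def)
  fix s t u assume st: "(rstep_on (terms F) R)\<^sup>*\<^sup>* s t" and su: "(rstep_on (terms F) R)\<^sup>*\<^sup>* s u"
  show "\<exists>v. (rstep_on (terms F) R)\<^sup>*\<^sup>* t v \<and> (rstep_on (terms F) R)\<^sup>*\<^sup>* u v"
  proof (cases "s \<in> terms F")
    \<comment> \<open>Outside \<open>terms F\<close> the restricted relation has no steps, so both
      reductions are empty.\<close>
    case False
    then have "t = s" "u = s" using st su by (auto elim: converse_rtranclpE simp: rstep_on_def)
    then show ?thesis by blast
  next
    case True
    then obtain n where "s \<in> rank_le n" using rank_exists by blast
    then obtain v where v: "steps t v" "steps u v"
      using CR st su rstep_on_steps unfolding confluent_rank_def by metis
    have "t \<in> terms F" "u \<in> terms F"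
      using steps_restrict[OF closed _ True] st su rstep_on_steps by blast+
    then show ?thesis using steps_restrict[OF closed] v by meson
  qed
qed

end

theorem theorem4p6:
  fixes F :: "('f \<times> nat) set"
    and \<LL> :: "('f, 'v :: countable) ctxt set"
    and R :: "('f, 'v) rule set"
  assumes "infinite (UNIV :: 'v set)"
    and "layer_system F \<LL>"
    and "is_trs F R"
    and "layered F \<LL> R"
    and "confluent_on (\<LL> \<inter> terms F) R"
  shows "confluent_trs F R"
  using assms by (intro layered_trs.confluent_trs) (unfold_locales)

end
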